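(* Let $p\in(0,p_0)$. Suppose there exist $t_0>0$ and $\delta>0$ such that, for any $t\in[0,t_0]$, whenever $n$ is large enough (possibly depending on $t$), $$\mathbb{E}\left(e^{t\left(L_n(\mathbf{Z}_n)-\ell_n(2nq)\right)}\right)\geq\nu_n\,M_q^{2n}(\delta t),$$ where $(\nu_n)_{n\in\mathbb{N}}\subseteq[0,\infty)$ is such that $\ln\nu_n=o(n)$ as $n\to\infty$. Then there exist constants $B>0$ and $\widetilde\gamma>0$ such that $$r(s)\leq B\,(s-\gamma^* )^2,\quad\text{for any }s\in(\gamma^*,\gamma^*+\widetilde\gamma].$$
   Context: Binary LCS setting: $\mathbf{X}_n=(X_1,\ldots,X_n)$ and $\mathbf{Y}_n=(Y_1,\ldots,Y_n)$ are the initial segments of two independent sequences of i.i.d. $\{0,1\}$-valued random variables with $\mathbb{P}(X_1=1)=\mathbb{P}(Y_1=1)=p\in(0,1)$, $q=1-p$, $\mathbf{Z}_n=(\mathbf{X}_n,\mathbf{Y}_n)$, and $L_n=L_n(\mathbf{Z}_n)$ is the length of the longest common subsequences of $\mathbf{X}_n$ and $\mathbf{Y}_n$. $U_n$ is the number of zeros in $\mathbf{Z}_n$, so $U_n\sim B(2n,q)$, and $\ell_n(u):=\mathbb{E}(L_n(\mathbf{Z}_n)\,|\,U_n=u)$ for $u\in\{0,\ldots,2n\}$. When $2nq$ is not an integer, $\ell_n(2nq)$ is read as $\ell_n(\lceil 2nq\rceil)$. $\gamma^*:=\lim_{n\to\infty}\mathbb{E}(L_n)/n$. The rate function is $r(s):=\lim_{n\to\infty}-\frac1n\ln\mathbb{P}(L_n\geq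 sn)=\inf_{n}-\frac1n\ln\mathbb{P}(L_n\geq sn)$, $s\geq0$ (the limit exists by subadditivity; with $-\ln 0=+\infty$). $M_q(t):=e^{t(1-q)}q+e^{-tq}(1-q)$, and $M_q^{2n}(\delta t)=(M_q(\delta t))^{2n}$. The constant $p_0$: given $\mathbf{Z}_n$, let $\widetilde{\mathbf{Z}}_n$ be obtained by choosing uniformly at random one of the ones in $\mathbf{Z}_n$ and turning it into a zero. By a known theorem (Lember–Matzinger), there exist constants $\varepsilon_1>\varepsilon_2>0$ and sets $B_n\subseteq\{0,1\}^n\times\{0,1\}^n$ such that for every $\mathbf{z}_n\in B_n$, $\mathbb{P}(L_n(\widetilde{\mathbf{Z}}_n)-L_n(\mathbf{Z}_n)=1\,|\,\mathbf{Z}_n=\mathbf{z}_n)\geq\varepsilon_1$ and $\mathbb{P}(L_n(\widetilde{\mathbf{Z}}_n)-L_n(\mathbf{Z}_n)=-1\,|\,\mathbf{Z}_n=\mathbf{z}_n)\leq\varepsilon_2$; moreover there exists $p_0>0$ such that for every $0<p<p_0$, $\mathbb{P}(\mathbf{Z}_n\in B_n)\geq 1-e^{-c_1n}$ for all large $n$, where $c_1>0$ does not depend on $n$ (but may depend on $p$). Fix such $p_0,\varepsilon_1,\varepsilon_2,c_1$; this theorem may be taken as given. *)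

theory Defs
  imports "HOL-Probability.Probability" "HOL-Library.Landau_Symbols" "HOL-Library.Sublist"
begin

text \<open>Letters are booleans: \<open>True\<close> is the letter 1 and \<open>False\<close> the letter 0.\<close>

type_synonym word_pair = "bool list \<times> bool list"

definition lcs_length :: "word_pair \<Rightarrow> nat" where
  "lcs_length z = Max {length w | w. subseq w (fst z) \<and> subseq w (snd z)}"

definition num_zeros :: "word_pair \<Rightarrow> nat" where
  "num_zeros z = count_list (fst z) False + count_list (snd z) False"

text \<open>Positions in a pair of words: \<open>Inl i\<close> is position \<open>i\<close> of the first word,
  \<open>Inr i\<close> position \<open>i\<close> of the second one.\<close>

definition one_positions :: "word_pair \<Rightarrow> (nat + nat) set" where
  "one_positions z =
     {Inl i | i. i < length (fst z) \<and> fst z ! i} \<union> {Inr i | i. i < length (snd z) \<and> snd z ! i}"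

fun zero_at :: "word_pair \<Rightarrow> nat + nat \<Rightarrow> word_pair" where
  "zero_at (x, y) (Inl i) = (x[i := False], y)"
| "zero_at (x, y) (Inr i) = (x, y[i := False])"

text \<open>The conditional law of \<open>Z\<^sub>n\<close>-tilde given \<open>Z\<^sub>n = z\<close>. A pair without ones is left unchanged
  (the random choice is impossible there).\<close>

definition tilde_pmf :: "word_pair \<Rightarrow> word_pair pmf" where
  "tilde_pmf z =
     (if one_positions z = {} then return_pmf z
      else map_pmf (zero_at z) (pmf_of_set (one_positions z)))"

text \<open>The law of \<open>Z\<^sub>n\<close> when ones have probability \<open>p\<close>.\<close>

definition Z_pmf :: "real \<Rightarrow> nat \<Rightarrow> word_pair pmf" where
  "Z_pmf p n = pair_pmf (replicate_pmf n (bernoulli_pmf p)) (replicate_pmf n (bernoulli_pmf p))"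

text \<open>The properties that the Lember--Matzinger theorem provides for its constants. The sets
  \<open>B n\<close> do not depend on \<open>p\<close>, whereas \<open>c1\<close> may.\<close>

definition lember_matzinger ::
  "real \<Rightarrow> real \<Rightarrow> real \<Rightarrow> (nat \<Rightarrow> word_pair set) \<Rightarrow> (real \<Rightarrow> real) \<Rightarrow> bool" where
  "lember_matzinger p0 eps1 eps2 B c1 \<longleftrightarrow>
     0 < p0 \<and> 0 < eps2 \<and> eps2 < eps1 \<and>
     (\<forall>n. B n \<subseteq> {(x, y). length x = n \<and> length y = n}) \<and>
     (\<forall>n. \<forall>z\<in>B n.
        measure_pmf.prob (tilde_pmf z) {z'. int (lcs_length z') - int (lcs_length z) = 1} \<ge> eps1 \<and>
        measure_pmf.prob (tilde_pmf z) {z'. int (lcs_length z') - int (lcs_length z) = -1} \<le> eps2) \<and>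
     (\<forall>p. 0 < p \<and> p < 1 \<and> p < p0 \<longrightarrow>
        0 < c1 p \<and>
        (\<forall>\<^sub>F n in sequentially.
           measure_pmf.prob (Z_pmf p n) (B n) \<ge> 1 - exp (- c1 p * real n)))"

definition M_gen :: "real \<Rightarrow> real \<Rightarrow> real" where
  "M_gen q t = exp (t * (1 - q)) * q + exp (- t * q) * (1 - q)"

text \<open>The function \<open>-ln\<close> on nonnegative reals with \<open>-ln 0 = \<infinity>\<close> (in HOL, \<open>ln 0 = 0\<close>).\<close>

definition neg_ln :: "real \<Rightarrow> ereal" where
  "neg_ln x = (if x = 0 then \<infinity> else ereal (- ln x))"

text \<open>Two independent i.i.d. sequences: all the variables \<open>X i\<close>, \<open>Y j\<close> together are independent.
  Indices start from 0, so \<open>X i\<close> is the letter with index \<open>i + 1\<close> in the usual numbering.\<close>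

locale binary_lcs = prob_space M for M :: "'a measure" +
  fixes X Y :: "nat \<Rightarrow> 'a \<Rightarrow> bool" and p :: real
  assumes p_pos: "0 < p" and p_less_1: "p < 1"
    and indep: "indep_vars (\<lambda>_. count_space UNIV) (case_sum X Y) UNIV"
    and prob_X: "\<And>i. prob {\<omega> \<in> space M. X i \<omega>} = p"
    and prob_Y: "\<And>i. prob {\<omega> \<in> space M. Y i \<omega>} = p"
begin

definition Z :: "nat \<Rightarrow> 'a \<Rightarrow> word_pair" where
  "Z n \<omega> = (map (\<lambda>i. X i \<omega>) [0..<n], map (\<lambda>i. Y i \<omega>) [0..<n])"

definition L :: "nat \<Rightarrow> 'a \<Rightarrow> real" where
  "L n \<omega> = real (lcs_length (Z n \<omega>))"

definition U :: "nat \<Rightarrow> 'a \<Rightarrow> nat" where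
  "U n \<omega> = num_zeros (Z n \<omega>)"

text \<open>\<open>E(L\<^sub>n | U\<^sub>n = u)\<close>; the event has positive probability for \<open>u \<le> 2 * n\<close>.\<close>

definition ell :: "nat \<Rightarrow> nat \<Rightarrow> real" where
  "ell n u = expectation (\<lambda>\<omega>. L n \<omega> * indicator {\<omega> \<in> space M. U n \<omega> = u} \<omega>)
             / prob {\<omega> \<in> space M. U n \<omega> = u}"

definition gamma_star :: real where
  "gamma_star = lim (\<lambda>n. expectation (L n) / real n)"

definition rate :: "real \<Rightarrow> ereal" where
  "rate s = lim (\<lambda>n. neg_ln (prob {\<omega> \<in> space M. L n \<omega> \<ge> s * real n}) / ereal (real n))"

end

end

theory Submission
  imports Defs
begin

text \<open>
  Write \<open>\<gamma>\<close> for \<open>\<gamma>\<^sup>*\<close> and let \<open>s = \<gamma> + d\<close>. Changing one letter changes the LCS by at most one, so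
  \<open>\<ell>\<^sub>n\<close> is 1-Lipschitz in the number of zeros, and since \<open>U\<^sub>n\<close> has standard deviation \<open>O(\<surd>n)\<close>,
  \<open>\<ell>\<^sub>n(2nq) \<ge> \<gamma> n - o(n)\<close>. As \<open>M\<^sub>q(\<tau>) \<ge> exp(const \<tau>\<^sup>2)\<close> for small \<open>\<tau>\<close>, the moment bound gives
  \<open>E exp(t L\<^sub>n) \<ge> exp(t \<gamma> n + c t\<^sup>2 n - o(n))\<close>. Take \<open>t = 2 d / c\<close>, so that \<open>c t\<^sup>2 = 2 t d\<close>. The moment is
  a sum over the \<open>n + 1\<close> values of \<open>L\<^sub>n\<close>, hence for some large \<open>n\<close> there is a value \<open>k > s n\<close> with
  \<open>P(L\<^sub>n \<ge> k) \<ge> exp(- t (k - \<gamma> n))\<close>. By superadditivity, concatenating such blocks with one long block of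
  typical LCS shows that \<open>r\<close> is bounded at \<open>s\<close> by linear interpolation between \<open>\<gamma>\<close> and \<open>k / n\<close>,
  so \<open>r(s) \<le> t (s - \<gamma>) = (2 / c) d\<^sup>2\<close>.
\<close>

subsection \<open>Subadditive sequences and common subsequences\<close>

text \<open>Fekete's lemma: the limit is the infimum of \<open>u n / n\<close> over
  \<open>n \<ge> 1\<close>. Dividing \<open>N\<close> by \<open>n\<close> with remainder bounds
  \<open>u N / N\<close> by \<open>u n / n\<close> up to a remainder term that vanishes in the
  limit.\<close>

lemma fekete:
  fixes u :: "nat \<Rightarrow> real"
  assumes sub: "\<And>m n. u (m + n) \<le> u m + u n" and nonneg: "\<And>n. 0 \<le> u n"
  obtains l where "(\<lambda>n. u n / real n) \<longlonglongrightarrow> l" "\<And>n. l * real n \<le> u n" "0 \<le> l"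
proof -
  define l where "l = (INF n\<in>{1..}. u n / real n)"
  have bdd: "bdd_below ((\<lambda>n. u n / real n) ` {1..})"
    by (rule bdd_belowI2[of _ 0]) (simp add: nonneg)
  have lower: "l \<le> u n / real n" if "n \<ge> 1" for n
    unfolding l_def by (rule cINF_lower[OF bdd]) (use that in auto)
  have mult: "u (k * n + r) \<le> real k * u n + u r" for k n r
  proof (induction k)
    case (Suc k)
    have "u (Suc k * n + r) \<le> u n + u (k * n + r)"
      using sub[of n "k * n + r"] by (simp add: add.assoc)
    with Suc show ?case by (simp add: algebra_simps)
  qed simp
  have lim: "(\<lambda>n. u n / real n) \<longlonglongrightarrow> l"
  proof (rule order_tendstoI)
    fix a assume "a < l"
    then show "\<forall>\<^sub>F n in sequentially. a < u n / real n"
      by (intro eventually_sequentiallyI[of 1]) (use lower in fastforce)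
  next
    fix a assume "l < a"
    then obtain n where n: "n \<ge> 1" "u n / real n < a"
      unfolding l_def using cInf_lessD[of "(\<lambda>n. u n / real n) ` {1..}" a] by auto
    \<comment> \<open>A bound for all possible remainders \<open>u (N mod n)\<close> at once,
      independent of \<open>N\<close>.\<close>
    define C where "C = (\<Sum>r<n. u r)"
    have ur: "u r \<le> C" if "r < n" for r
      unfolding C_def using that by (intro member_le_sum) (auto simp: nonneg)
    have bound: "u N / real N \<le> u n / real n + C / real N" if "N \<ge> 1" for N
    proof -
      have "u N \<le> real (N div n) * u n + u (N mod n)"
        using mult[of "N div n" n "N mod n"] by simp
      also have "\<dots> \<le> (real N / real n) * u n + C"
        using n ur[of "N mod n"] nonneg[of n] of_nat_div_le_of_nat[of N n]
        by (intro add_mono mult_right_mono) auto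
      finally show ?thesis using that n by (simp add: field_simps)
    qed
    have "(\<lambda>N. u n / real n + C / real N) \<longlonglongrightarrow> u n / real n + 0"
      by (intro tendsto_intros lim_const_over_n)
    then have "\<forall>\<^sub>F N in sequentially. u n / real n + C / real N < a"
      by (rule order_tendstoD) (use n in simp)
    with eventually_ge_at_top[of 1] show "\<forall>\<^sub>F N in sequentially. u N / real N < a"
      by eventually_elim (use bound in fastforce)
  qed
  show ?thesis
  proof (rule that[OF lim])
    show "l * real n \<le> u n" for n
      using lower[of n] nonneg[of n] by (cases "n = 0") (auto simp: field_simps)
    show "0 \<le> l"
      by (rule LIMSEQ_le_const[OF lim]) (simp add: nonneg)
  qed
qed

section \<open>Common subsequences under concatenation and under change of one letter\<close>

lemma finite_common_subseq_lengths:
  "finite {length w | w. subseq w (x :: 'a list) \<and> subseq w y}"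
  by (rule finite_subset[of _ "{..length x}"]) (auto dest: list_emb_length)

lemma lcs_length_attained:
  obtains w where "subseq w x" "subseq w y" "length w = lcs_length (x, y)"
proof -
  have "lcs_length (x, y) \<in> {length w | w. subseq w x \<and> subseq w y}"
    unfolding lcs_length_def fst_conv snd_conv
    by (rule Max_in[OF finite_common_subseq_lengths]) auto
  then obtain w where "lcs_length (x, y) = length w" "subseq w x" "subseq w y"
    by blast
  then show ?thesis using that[of w] by simp
qed

lemma lcs_length_ge:
  assumes "subseq w x" "subseq w y"
  shows "length w \<le> lcs_length (x, y)"
  unfolding lcs_length_def fst_conv snd_conv
  by (rule Max_ge[OF finite_common_subseq_lengths]) (use assms in auto)

lemma lcs_length_le: "lcs_length (x, y) \<le> length x"
  by (metis lcs_length_attained list_emb_length)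

lemma lcs_length_commute: "lcs_length (x, y) = lcs_length (y, x)"
  by (metis lcs_length_attained lcs_length_ge order_antisym)

lemma lcs_length_append:
  "lcs_length (x, y) + lcs_length (x', y') \<le> lcs_length (x @ x', y @ y')"
proof -
  obtain w where w: "subseq w x" "subseq w y" "length w = lcs_length (x, y)"
    by (rule lcs_length_attained)
  obtain w' where w': "subseq w' x'" "subseq w' y'" "length w' = lcs_length (x', y')"
    by (rule lcs_length_attained)
  from w w' have "length (w @ w') \<le> lcs_length (x @ x', y @ y')"
    by (intro lcs_length_ge list_emb_append_mono)
  with w w' show ?thesis by simp
qed

text \<open>Split a longest common subsequence into the parts embedded before, at and after position
  \<open>i\<close>. Omitting the middle part loses at most one letter, and the rest does not see the
  letter at \<open>i\<close>.\<close>

lemma lcs_length_list_update_le: "lcs_length (x, y) \<le> lcs_length (x[i := b], y) + 1"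
proof (cases "i < length x")
  case True
  obtain w where w: "subseq w x" "subseq w y" "length w = lcs_length (x, y)"
    by (rule lcs_length_attained)
  have "subseq w (take i x @ [x ! i] @ drop (Suc i) x)"
    using w(1) True by (simp add: id_take_nth_drop[symmetric])
  then obtain w1 w2 w3 where split: "w = w1 @ w2 @ w3"
      "subseq w1 (take i x)" "subseq w2 [x ! i]" "subseq w3 (drop (Suc i) x)"
    by (metis subseq_appendE)
  have "subseq (w1 @ [] @ w3) (take i x @ [b] @ drop (Suc i) x)"
    using split by (intro list_emb_append_mono) auto
  then have "subseq (w1 @ w3) (x[i := b])"
    using True by (simp add: upd_conv_take_nth_drop)
  moreover have "subseq (w1 @ w3) y"
  proof -
    have "subseq (w1 @ [] @ w3) w"
      unfolding split(1) by (intro list_emb_append_mono) auto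
    then show ?thesis using w(2) by (auto intro: subseq_order.trans)
  qed
  ultimately have "length (w1 @ w3) \<le> lcs_length (x[i := b], y)"
    by (rule lcs_length_ge)
  moreover have "length w2 \<le> 1"
    using list_emb_length[OF split(3)] by simp
  ultimately show ?thesis using w(3) split(1) by simp
qed (simp add: list_update_beyond)

lemma lcs_length_list_update:
  "\<bar>real (lcs_length (x[i := b], y)) - real (lcs_length (x, y))\<bar> \<le> 1"
  \<comment> \<open>The reverse inequality comes from writing the old letter \<open>x ! i\<close>
    back.\<close>
  using lcs_length_list_update_le[of x y i b]
    lcs_length_list_update_le[of "x[i := b]" y i "x ! i"] by simp

subsection \<open>Random subsets\<close>

text \<open>The law of a random subset of \<open>I\<close> that contains each point independently
  with probability \<open>q\<close>; \<open>mean\<close> is the expectation under it. Expectations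
  thus become finite sums.\<close>

definition weight :: "real \<Rightarrow> 'i set \<Rightarrow> 'i set \<Rightarrow> real" where
  "weight q I A = (\<Prod>j\<in>I. if j \<in> A then q else 1 - q)"

definition mean :: "real \<Rightarrow> 'i set \<Rightarrow> ('i set \<Rightarrow> real) \<Rightarrow> real" where
  "mean q I g = (\<Sum>A\<in>Pow I. weight q I A * g A)"

lemma weight_card:
  assumes "finite I" "A \<subseteq> I"
  shows "weight q I A = q ^ card A * (1 - q) ^ (card I - card A)"
proof -
  have "weight q I A = (\<Prod>j\<in>A. q) * (\<Prod>j\<in>I - A. 1 - q)"
    unfolding weight_def using assms
    by (subst prod.subset_diff[of A I]) (auto intro!: prod.cong simp: mult.commute)
  then show ?thesis
    using assms by (simp add: card_Diff_subset finite_subset)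
qed

lemma weight_nonneg: "0 \<le> q \<Longrightarrow> q \<le> 1 \<Longrightarrow> 0 \<le> weight q I A"
  unfolding weight_def by (intro prod_nonneg) auto

lemma weight_pos: "0 < q \<Longrightarrow> q < 1 \<Longrightarrow> 0 < weight q I A"
  unfolding weight_def by (intro prod_pos) auto

lemma mean_mono:
  assumes "0 \<le> q" "q \<le> 1" "\<And>A. A \<subseteq> I \<Longrightarrow> g A \<le> h A"
  shows "mean q I g \<le> mean q I h"
  unfolding mean_def by (intro sum_mono mult_left_mono weight_nonneg) (use assms in auto)

lemma mean_cong: "(\<And>A. A \<subseteq> I \<Longrightarrow> g A = h A) \<Longrightarrow> mean q I g = mean q I h"
  unfolding mean_def by (intro sum.cong) auto

lemma mean_add: "mean q I (\<lambda>A. g A + h A) = mean q I g + mean q I h"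
  unfolding mean_def by (simp add: distrib_left sum.distrib)

lemma mean_cmult: "mean q I (\<lambda>A. c * g A) = c * mean q I g"
  unfolding mean_def by (simp add: sum_distrib_left mult.left_commute)

lemma mean_multc: "mean q I (\<lambda>A. g A * c) = mean q I g * c"
  using mean_cmult[of q I c g] by (simp add: mult.commute)

lemma mean_sum: "mean q I (\<lambda>A. \<Sum>k\<in>K. g k A) = (\<Sum>k\<in>K. mean q I (g k))"
  unfolding mean_def by (simp add: sum_distrib_left sum.swap[of _ K])

text \<open>Grouping the sets by size gives the binomial law, whose weights are the Bernstein
  polynomials.\<close>

lemma mean_card:
  assumes "finite I"
  shows "mean q I (\<lambda>A. g (card A)) = (\<Sum>k\<le>card I. Bernstein (card I) k q * g k)"
proof -
  have "mean q I (\<lambda>A. g (card A)) =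
      (\<Sum>A\<in>Pow I. q ^ card A * (1 - q) ^ (card I - card A) * g (card A))"
    unfolding mean_def using assms by (intro sum.cong) (auto simp: weight_card)
  also have "\<dots> = (\<Sum>k\<le>card I. \<Sum>A | A \<in> Pow I \<and> card A = k.
      q ^ card A * (1 - q) ^ (card I - card A) * g (card A))"
    using assms by (subst sum.group) (auto intro: card_mono)
  also have "\<dots> = (\<Sum>k\<le>card I. Bernstein (card I) k q * g k)"
  proof (rule sum.cong)
    fix k
    have "card {A. A \<in> Pow I \<and> card A = k} = card I choose k"
      using n_subsets[OF assms, of k] by (simp add: conj_commute)
    then show "(\<Sum>A | A \<in> Pow I \<and> card A = k.
        q ^ card A * (1 - q) ^ (card I - card A) * g (card A)) = Bernstein (card I) k q * g k"
      by (simp add: Bernstein_def)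
  qed simp
  finally show ?thesis .
qed

lemma mean_const: "finite I \<Longrightarrow> mean q I (\<lambda>_. c) = c"
  using mean_card[of I q "\<lambda>_. c"] by (simp add: sum_distrib_right[symmetric])

text \<open>Independence of the two parts: a subset of a disjoint union is a pair of subsets, and
  its weight factorises.\<close>

lemma mean_Un:
  assumes "finite I" "finite J" "I \<inter> J = {}"
  shows "mean q (I \<union> J) g = mean q I (\<lambda>A. mean q J (\<lambda>B. g (A \<union> B)))"
proof -
  have w: "weight q (I \<union> J) (A \<union> B) = weight q I A * weight q J B" if "A \<subseteq> I" "B \<subseteq> J" for A B
  proof -
    have "weight q I (A \<union> B) = weight q I A" "weight q J (A \<union> B) = weight q J B"
      unfolding weight_def using that assms by (auto intro!: prod.cong)
    then show ?thesis
      unfolding weight_def using assms by (simp add: prod.union_disjoint)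
  qed
  have "bij_betw (\<lambda>(A, B). A \<union> B) (Pow I \<times> Pow J) (Pow (I \<union> J))"
    by (rule bij_betw_byWitness[of _ "\<lambda>C. (C \<inter> I, C \<inter> J)"]) (use assms in auto)
  then have "mean q (I \<union> J) g =
      (\<Sum>(A, B)\<in>Pow I \<times> Pow J. weight q (I \<union> J) (A \<union> B) * g (A \<union> B))"
    unfolding mean_def by (subst sum.reindex_bij_betw[symmetric]) (auto intro: sum.cong)
  also have "\<dots> = (\<Sum>(A, B)\<in>Pow I \<times> Pow J. weight q I A * (weight q J B * g (A \<union> B)))"
    by (intro sum.cong) (auto simp: w)
  also have "\<dots> = mean q I (\<lambda>A. mean q J (\<lambda>B. g (A \<union> B)))"
    unfolding mean_def sum_distrib_left by (rule sum.cartesian_product[symmetric])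
  finally show ?thesis .
qed

lemma mean_image:
  assumes "inj h"
  shows "mean q (h ` J) g = mean q J (\<lambda>B. g (h ` B))"
proof -
  have "weight q (h ` J) (h ` B) = weight q J B" for B
    unfolding weight_def using assms
    by (subst prod.reindex) (auto intro: inj_on_subset simp: inj_image_mem_iff)
  moreover have "Pow (h ` J) = (\<lambda>B. h ` B) ` Pow J"
    by (auto simp: subset_image_iff)
  moreover have "inj_on ((`) h) (Pow J)"
    by (rule inj_on_image_Pow[OF inj_on_subset[OF assms subset_UNIV]])
  ultimately show ?thesis
    unfolding mean_def by (simp add: sum.reindex)
qed

text \<open>The mean deviation is controlled by the variance \<open>N q (1 - q)\<close>, which
  follows from the first two factorial moments of the binomial law.\<close>

lemma mean_abs_card_diff:
  assumes "finite I" and "0 \<le> q" "q \<le> 1"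
  shows "mean q I (\<lambda>A. \<bar>real (card A) - real (card I) * q\<bar>) \<le> sqrt (real (card I))"
proof -
  define N where "N = card I"
  have m1: "mean q I (\<lambda>A. real (card A)) = real N * q"
    using mean_card[OF assms(1), of q real] by (simp add: N_def mult.commute[of "Bernstein _ _ _"])
  have m2: "mean q I (\<lambda>A. real (card A) * (real (card A) - 1)) = real N * (real N - 1) * q\<^sup>2"
    using mean_card[OF assms(1), of q "\<lambda>k. real k * (real k - 1)"]
    by (simp add: N_def mult.commute[of "Bernstein _ _ _"])
  have var: "mean q I (\<lambda>A. (real (card A) - real N * q)\<^sup>2) = real N * q * (1 - q)"
  proof -
    have "mean q I (\<lambda>A. (real (card A) - real N * q)\<^sup>2) =
      mean q I (\<lambda>A. real (card A) * (real (card A) - 1) + ((1 - 2 * (real N * q)) * real (card A)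
        + (real N * q)\<^sup>2))"
      by (rule mean_cong) (simp add: power2_eq_square algebra_simps)
    also have "\<dots> = real N * (real N - 1) * q\<^sup>2 + ((1 - 2 * (real N * q)) * (real N * q) + (real N * q)\<^sup>2)"
      by (simp only: mean_add mean_cmult m1 m2 mean_const[OF assms(1)])
    finally show ?thesis by (simp add: power2_eq_square algebra_simps)
  qed
  show ?thesis
  proof (cases "N = 0")
    case True
    then show ?thesis
      using assms(1) unfolding N_def mean_def by simp
  next
    case False
    \<comment> \<open>In place of Cauchy-Schwarz,
      \<open>x \<le> \<sigma> / 2 + x^2 / (2 \<sigma>)\<close> is averaged; with this
      \<open>\<sigma>\<close> each of the two terms contributes at most
      \<open>\<sigma> / 2\<close>.\<close>
    define \<sigma> where "\<sigma> = sqrt (real N)"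
    have \<sigma>: "\<sigma> > 0" "\<sigma>\<^sup>2 = real N" using False by (auto simp: \<sigma>_def)
    have "mean q I (\<lambda>A. \<bar>real (card A) - real N * q\<bar>) \<le>
        mean q I (\<lambda>A. \<sigma> / 2 + (real (card A) - real N * q)\<^sup>2 * (1 / (2 * \<sigma>)))"
    proof (rule mean_mono)
      fix A
      define x where "x = \<bar>real (card A) - real N * q\<bar>"
      have "0 \<le> (\<sigma> - x)\<^sup>2" by simp
      then have "x \<le> \<sigma> / 2 + x\<^sup>2 * (1 / (2 * \<sigma>))"
        using \<sigma>(1) by (simp add: power2_eq_square field_simps)
      then show "\<bar>real (card A) - real N * q\<bar> \<le>
          \<sigma> / 2 + (real (card A) - real N * q)\<^sup>2 * (1 / (2 * \<sigma>))"
        by (simp add: x_def)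
    qed (use assms in auto)
    also have "\<dots> = \<sigma> / 2 + real N * (q * (1 - q)) * (1 / (2 * \<sigma>))"
      by (simp only: mean_add mean_multc var mean_const[OF assms(1)] mult.assoc)
    also have "\<dots> \<le> \<sigma> / 2 + real N * 1 * (1 / (2 * \<sigma>))"
      using assms \<sigma> mult_le_one[of q "1 - q"]
      by (intro add_left_mono mult_right_mono mult_left_mono) auto
    also have "\<dots> = \<sigma>"
      using \<sigma> by (simp add: field_simps power2_eq_square)
    finally show ?thesis by (simp add: \<sigma>_def N_def)
  qed
qed

text \<open>The conditional expectation of \<open>f\<close> given that the random set has
  \<open>u\<close> elements. All sets of one size have equal weight, so it is a uniform average and
  does not depend on \<open>q\<close>.\<close>

definition slice_mean :: "'i set \<Rightarrow> ('i set \<Rightarrow> real) \<Rightarrow> nat \<Rightarrow> real" where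
  "slice_mean I f u = (\<Sum>A | A \<subseteq> I \<and> card A = u. f A) / real (card I choose u)"

text \<open>Double counting of the pairs \<open>(A, i)\<close> with \<open>i \<notin> A\<close>, sent to \<open>(insert i A, i)\<close>.\<close>

lemma slice_mean_Suc:
  assumes fin: "finite I" and u: "u < card I"
    and lip: "\<And>A i. A \<subseteq> I \<Longrightarrow> i \<in> I \<Longrightarrow> \<bar>f (insert i A) - f A\<bar> \<le> 1"
  shows "\<bar>slice_mean I f (Suc u) - slice_mean I f u\<bar> \<le> 1"
proof -
  define N where "N = card I"
  define S where "S = (\<lambda>u. {A. A \<subseteq> I \<and> card A = u})"
  have finS: "finite (S u)" for u
    unfolding S_def using fin by simp
  have cardS: "card (S u) = N choose u" for u
    unfolding S_def N_def using n_subsets[OF fin] by simp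
  note finI = rev_finite_subset[OF fin]
  have card_compl: "card (I - A) = N - u" if "A \<in> S u" for A u
    using that by (simp add: S_def N_def card_Diff_subset finI)
  define P where "P = (SIGMA A:S u. I - A)"
  have sum_low: "(\<Sum>(A, i)\<in>P. f A) = real (N - u) * (\<Sum>A\<in>S u. f A)"
  proof -
    have "(\<Sum>(A, i)\<in>P. f A) = (\<Sum>A\<in>S u. \<Sum>i\<in>I - A. f A)"
      unfolding P_def using finS fin by (subst sum.Sigma) auto
    also have "\<dots> = (\<Sum>A\<in>S u. real (N - u) * f A)"
      by (intro sum.cong) (simp_all add: card_compl)
    finally show ?thesis by (simp add: sum_distrib_left)
  qed
  have sum_up: "(\<Sum>(A, i)\<in>P. f (insert i A)) = real (Suc u) * (\<Sum>A\<in>S (Suc u). f A)"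
  proof -
    have "bij_betw (\<lambda>(A, i). (insert i A, i)) P (SIGMA A:S (Suc u). A)"
    proof (rule bij_betw_byWitness[of _ "\<lambda>(A, i). (A - {i}, i)"])
      show "(\<lambda>(A, i). (insert i A, i)) ` P \<subseteq> (SIGMA A:S (Suc u). A)"
        unfolding P_def S_def by (auto simp: card_insert_if finI)
      show "(\<lambda>(A, i). (A - {i}, i)) ` (SIGMA A:S (Suc u). A) \<subseteq> P"
        unfolding P_def S_def by (auto simp: card_Diff_singleton finI)
    qed (auto simp: P_def S_def)
    then have "(\<Sum>(A, i)\<in>P. f (insert i A)) = (\<Sum>(A, i)\<in>(SIGMA A:S (Suc u). A). f A)"
      by (subst sum.reindex_bij_betw[symmetric]) (auto intro: sum.cong)
    also have "\<dots> = (\<Sum>A\<in>S (Suc u). \<Sum>i\<in>A. f A)"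
      by (subst sum.Sigma) (use finS in \<open>auto simp: S_def finI\<close>)
    also have "\<dots> = (\<Sum>A\<in>S (Suc u). real (Suc u) * f A)"
      by (intro sum.cong) (auto simp: S_def)
    finally show ?thesis by (simp add: sum_distrib_left)
  qed
  \<comment> \<open>Both sides count \<open>P\<close>, once through the smaller and once through the
    larger set, so both slice means get the same denominator.\<close>
  have choose: "real (Suc u) * real (N choose Suc u) = real (N - u) * real (N choose u)"
  proof -
    have "Suc u * (N choose Suc u) = (N - u) * (N choose u)"
      using u binomial_absorb_comp[of N u] binomial_absorption[of u "N"]
      by (metis N_def Suc_diff_1 binomial_absorb_comp binomial_absorption not_gr_zero not_less0)
    then show ?thesis by (metis of_nat_mult)
  qed
  have cardP: "real (card P) = real (N - u) * real (N choose u)"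
  proof -
    have "card P = (\<Sum>A\<in>S u. card (I - A))"
      unfolding P_def using finS fin by (intro card_SigmaI) auto
    also have "\<dots> = (\<Sum>A\<in>S u. N - u)"
      by (intro sum.cong) (simp_all add: card_compl)
    finally show ?thesis by (simp add: cardS)
  qed
  have pos: "real (card P) > 0"
    using u unfolding cardP N_def by (simp add: zero_less_binomial_iff)
  \<comment> \<open>Both slice means are now averages over \<open>P\<close>; their difference is an
    average of one-point increments of \<open>f\<close>.\<close>
  have low: "slice_mean I f u = (\<Sum>(A, i)\<in>P. f A) / real (card P)"
    unfolding sum_low cardP slice_mean_def using u by (simp add: N_def S_def)
  have up: "slice_mean I f (Suc u) = (\<Sum>(A, i)\<in>P. f (insert i A)) / real (card P)"
    unfolding sum_up cardP choose[symmetric] slice_mean_def using u by (simp add: N_def S_def del: of_nat_Suc)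
  have "\<bar>(\<Sum>(A, i)\<in>P. f (insert i A)) - (\<Sum>(A, i)\<in>P. f A)\<bar> =
      \<bar>\<Sum>z\<in>P. f (insert (snd z) (fst z)) - f (fst z)\<bar>"
    by (simp add: sum_subtractf split_def)
  also have "\<dots> \<le> (\<Sum>z\<in>P. \<bar>f (insert (snd z) (fst z)) - f (fst z)\<bar>)"
    by (rule sum_abs)
  also have "\<dots> \<le> (\<Sum>z\<in>P. 1)"
    by (intro sum_mono lip) (auto simp: P_def S_def)
  finally show ?thesis
    unfolding low up using pos by (simp add: diff_divide_distrib[symmetric] abs_divide)
qed

lemma slice_mean_lipschitz:
  assumes fin: "finite I" and "u \<le> card I" "v \<le> card I"
    and lip: "\<And>A i. A \<subseteq> I \<Longrightarrow> i \<in> I \<Longrightarrow> \<bar>f (insert i A) - f A\<bar> \<le> 1"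
  shows "\<bar>slice_mean I f u - slice_mean I f v\<bar> \<le> \<bar>real u - real v\<bar>"
proof -
  have up: "\<bar>slice_mean I f (u + d) - slice_mean I f u\<bar> \<le> real d" if "u + d \<le> card I" for u d
    using that
  proof (induction d)
    case (Suc d)
    with slice_mean_Suc[OF fin _ lip, of "u + d"] show ?case by force
  qed simp
  show ?thesis
  proof (cases "u \<le> v")
    case True
    then show ?thesis using up[of u "v - u"] assms by simp
  next
    case False
    then show ?thesis using up[of v "u - v"] assms by simp
  qed
qed

text \<open>The common weight of the sets of size \<open>u\<close> factors out, leaving the binomial
  probability of that size times the uniform average. If there is no such set, both sides
  vanish.\<close>

lemma mean_restrict_card:
  assumes "finite I"
  shows "mean q I (\<lambda>A. f A * of_bool (card A = u)) = Bernstein (card I) u q * slice_mean I f u"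
proof -
  have "mean q I (\<lambda>A. f A * of_bool (card A = u)) =
      (\<Sum>A | A \<subseteq> I \<and> card A = u. weight q I A * f A)"
    unfolding mean_def using assms by (intro sum.mono_neutral_cong_right) auto
  also have "\<dots> = (\<Sum>A | A \<subseteq> I \<and> card A = u. q ^ u * (1 - q) ^ (card I - u) * f A)"
    using assms by (intro sum.cong) (auto simp: weight_card)
  also have "\<dots> = q ^ u * (1 - q) ^ (card I - u) * (\<Sum>A | A \<subseteq> I \<and> card A = u. f A)"
    by (simp add: sum_distrib_left)
  finally have eq: "mean q I (\<lambda>A. f A * of_bool (card A = u)) = \<dots>" .
  show ?thesis
  proof (cases "card I choose u = 0")
    case True
    then have "card {A. A \<subseteq> I \<and> card A = u} = 0"
      using n_subsets[OF assms, of u] by simp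
    moreover have "finite {A. A \<subseteq> I \<and> card A = u}"
      using assms by simp
    ultimately have empty: "{A. A \<subseteq> I \<and> card A = u} = {}"
      by (simp only: card_0_eq)
    show ?thesis unfolding eq Bernstein_def empty True by simp
  next
    case False
    then show ?thesis by (simp add: eq Bernstein_def slice_mean_def)
  qed
qed

text \<open>The tower property, conditioning on the size of the random set.\<close>

lemma mean_slice_mean:
  assumes "finite I"
  shows "mean q I f = mean q I (\<lambda>A. slice_mean I f (card A))"
proof -
  have "mean q I f = mean q I (\<lambda>A. \<Sum>u\<le>card I. f A * of_bool (card A = u))"
  proof (rule mean_cong)
    fix A assume "A \<subseteq> I"
    then have "card A \<le> card I" using assms by (rule card_mono[rotated])
    then show "f A = (\<Sum>u\<le>card I. f A * of_bool (card A = u))"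
      by (simp add: sum_distrib_left[symmetric])
  qed
  then show ?thesis
    using assms by (simp only: mean_sum mean_restrict_card mean_card)
qed

subsection \<open>The LCS as a function of the zero positions\<close>

text \<open>The sum type matches the index type of the family \<open>case_sum X Y\<close>, so that a
  pair of words is a single random subset.\<close>

definition pos :: "nat \<Rightarrow> (nat + nat) set" where
  "pos n = {..<n} <+> {..<n}"

text \<open>A pair of words is encoded by the set of positions of its zeros.\<close>

definition zero_word :: "nat \<Rightarrow> (nat + nat) set \<Rightarrow> word_pair" where
  "zero_word n A = (map (\<lambda>i. Inl i \<notin> A) [0..<n], map (\<lambda>i. Inr i \<notin> A) [0..<n])"

definition lcs :: "nat \<Rightarrow> (nat + nat) set \<Rightarrow> real" where
  "lcs n A = real (lcs_length (zero_word n A))"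

text \<open>Appending a second pair of words after a pair of length \<open>n\<close> translates the
  positions of the second pair by \<open>n\<close> in both words.\<close>

definition shift :: "nat \<Rightarrow> nat + nat \<Rightarrow> nat + nat" where
  "shift n = map_sum ((+) n) ((+) n)"

lemma finite_pos [simp]: "finite (pos n)"
  by (simp add: pos_def)

lemma card_pos [simp]: "card (pos n) = 2 * n"
  by (simp add: pos_def card_Plus)

lemma inj_shift: "inj (shift n)"
  unfolding shift_def by (intro sum.inj_map) auto

lemma pos_add: "pos (n + m) = pos n \<union> shift n ` pos m"
proof (intro set_eqI iffI)
  fix j assume j: "j \<in> pos (n + m)"
  show "j \<in> pos n \<union> shift n ` pos m"
  proof (cases j)
    case (Inl i)
    then show ?thesis
      using j by (cases "i < n") (auto simp: pos_def shift_def intro!: image_eqI[of _ _ "Inl (i - n)"])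
  next
    case (Inr i)
    then show ?thesis
      using j by (cases "i < n") (auto simp: pos_def shift_def intro!: image_eqI[of _ _ "Inr (i - n)"])
  qed
qed (auto simp: pos_def shift_def)

lemma pos_Int_shift: "pos n \<inter> shift n ` pos m = {}"
  by (auto simp: pos_def shift_def)

lemma num_zeros_zero_word:
  assumes "A \<subseteq> pos n"
  shows "num_zeros (zero_word n A) = card A"
proof -
  have count: "count_list (map (\<lambda>i. h i \<notin> A) [0..<n]) False = card {i. i < n \<and> h i \<in> A}"
    for h :: "nat \<Rightarrow> nat + nat"
    unfolding count_list_eq_length_filter
    by (simp add: length_filter_conv_card conj_commute cong: conj_cong)
  have "card ({i. i < n \<and> Inl i \<in> A} <+> {i. i < n \<and> Inr i \<in> A}) =
      card {i. i < n \<and> Inl i \<in> A} + card {i. i < n \<and> Inr i \<in> A}"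
    by (rule card_Plus) auto
  moreover have "{i. i < n \<and> Inl i \<in> A} <+> {i. i < n \<and> Inr i \<in> A} = A"
    using assms by (auto simp: pos_def)
  ultimately have "card A = card {i. i < n \<and> Inl i \<in> A} + card {i. i < n \<and> Inr i \<in> A}"
    by simp
  then show ?thesis
    by (simp add: num_zeros_def zero_word_def count)
qed

lemma lcs_nonneg: "0 \<le> lcs n A"
  by (simp add: lcs_def)

lemma lcs_le: "lcs n A \<le> real n"
  using lcs_length_le[of "fst (zero_word n A)" "snd (zero_word n A)"]
  by (simp add: lcs_def zero_word_def)

lemma map_upt_list_update:
  "(map P [0..<n])[i := c] = map (\<lambda>k. if k = i then c else P k) [0..<n]"
  by (cases "i < n") (auto simp: list_eq_iff_nth_eq nth_list_update list_update_beyond)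

text \<open>Inserting a position overwrites one letter by a zero (or changes nothing). This is the
  increment hypothesis of \<open>slice_mean_lipschitz\<close>; the second word is handled by
  symmetry of the LCS.\<close>

lemma lcs_insert: "\<bar>lcs n (insert j A) - lcs n A\<bar> \<le> 1"
proof (cases j)
  case (Inl i)
  then have "zero_word n (insert j A) = ((fst (zero_word n A))[i := False], snd (zero_word n A))"
    by (auto simp: zero_word_def map_upt_list_update)
  then show ?thesis
    using lcs_length_list_update[of "fst (zero_word n A)" i False "snd (zero_word n A)"]
    by (simp add: lcs_def)
next
  case (Inr i)
  then have "zero_word n (insert j A) = (fst (zero_word n A), (snd (zero_word n A))[i := False])"
    by (auto simp: zero_word_def map_upt_list_update)
  then show ?thesis
    using lcs_length_list_update[of "snd (zero_word n A)" i False "fst (zero_word n A)"]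
      lcs_length_commute[of "snd (zero_word n A)" "fst (zero_word n A)"]
      lcs_length_commute[of "(snd (zero_word n A))[i := False]" "fst (zero_word n A)"]
    by (simp add: lcs_def)
qed

text \<open>The union with a shifted set encodes the concatenation of the two pairs of words, so
  \<open>lcs_length_append\<close> applies.\<close>

lemma lcs_shift:
  assumes "A \<subseteq> pos n" "B \<subseteq> pos m"
  shows "lcs n A + lcs m B \<le> lcs (n + m) (A \<union> shift n ` B)"
proof -
  have mem: "Inl i \<in> shift n ` B \<longleftrightarrow> n \<le> i \<and> Inl (i - n) \<in> B"
    "Inr i \<in> shift n ` B \<longleftrightarrow> n \<le> i \<and> Inr (i - n) \<in> B" for i
  proof -
    have "shift n k = Inl i \<longleftrightarrow> n \<le> i \<and> k = Inl (i - n)"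
      "shift n k = Inr i \<longleftrightarrow> n \<le> i \<and> k = Inr (i - n)" for k
      by (cases k; auto simp: shift_def)+
    then show "Inl i \<in> shift n ` B \<longleftrightarrow> n \<le> i \<and> Inl (i - n) \<in> B"
      "Inr i \<in> shift n ` B \<longleftrightarrow> n \<le> i \<and> Inr (i - n) \<in> B"
      by (metis image_iff)+
  qed
  have out: "Inl i \<notin> A" "Inr i \<notin> A" if "n \<le> i" for i
    using assms(1) that by (auto simp: pos_def)
  have "zero_word (n + m) (A \<union> shift n ` B) =
      (fst (zero_word n A) @ fst (zero_word m B), snd (zero_word n A) @ snd (zero_word m B))"
    by (auto simp: zero_word_def list_eq_iff_nth_eq nth_append mem out)
  then show ?thesis
    using lcs_length_append[of "fst (zero_word n A)" "snd (zero_word n A)"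
        "fst (zero_word m B)" "snd (zero_word m B)"]
    by (simp add: lcs_def of_nat_add[symmetric] del: of_nat_add)
qed

lemma mean_pos_add:
  "mean q (pos (n + m)) g = mean q (pos n) (\<lambda>A. mean q (pos m) (\<lambda>B. g (A \<union> shift n ` B)))"
  unfolding pos_add
  by (simp add: mean_Un pos_Int_shift mean_image[OF inj_shift])

section \<open>Superadditivity of the mean and of the upper tail\<close>

definition mean_lcs :: "real \<Rightarrow> nat \<Rightarrow> real" where
  "mean_lcs q n = mean q (pos n) (lcs n)"

definition tail :: "real \<Rightarrow> nat \<Rightarrow> real \<Rightarrow> real" where
  "tail q n a = mean q (pos n) (\<lambda>A. of_bool (a \<le> lcs n A))"

lemma mean_lcs_add:
  assumes q: "0 < q" "q < 1"
  shows "mean_lcs q n + mean_lcs q m \<le> mean_lcs q (n + m)"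
proof -
  have "mean_lcs q n + mean_lcs q m = mean q (pos n) (\<lambda>A. mean q (pos m) (\<lambda>B. lcs n A + lcs m B))"
    by (simp add: mean_lcs_def mean_add mean_const)
  also have "\<dots> \<le> mean_lcs q (n + m)"
    unfolding mean_lcs_def mean_pos_add using q by (intro mean_mono lcs_shift) auto
  finally show ?thesis .
qed

text \<open>Two adjacent blocks are independent, and if both exceed their thresholds then so does
  the concatenation. Hence \<open>- ln\<close> of the tail is subadditive.\<close>

lemma tail_mult:
  assumes q: "0 < q" "q < 1"
  shows "tail q n a * tail q m b \<le> tail q (n + m) (a + b)"
proof -
  have "tail q n a * tail q m b = mean q (pos n) (\<lambda>A. mean q (pos m)
      (\<lambda>B. of_bool (a \<le> lcs n A) * of_bool (b \<le> lcs m B)))"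
    unfolding tail_def by (simp only: mean_cmult mean_multc)
  also have "\<dots> \<le> tail q (n + m) (a + b)"
    unfolding tail_def mean_pos_add
  proof (intro mean_mono)
    fix A B assume "A \<subseteq> pos n" "B \<subseteq> pos m"
    from lcs_shift[OF this]
    show "of_bool (a \<le> lcs n A) * of_bool (b \<le> lcs m B)
        \<le> (of_bool (a + b \<le> lcs (n + m) (A \<union> shift n ` B)) :: real)"
      by auto
  qed (use q in auto)
  finally show ?thesis .
qed

lemma tail_nonneg:
  assumes q: "0 < q" "q < 1"
  shows "0 \<le> tail q n a"
  unfolding tail_def mean_def using q by (intro sum_nonneg mult_nonneg_nonneg weight_nonneg) auto

lemma tail_antimono:
  assumes q: "0 < q" "q < 1" and "a \<le> b"
  shows "tail q n b \<le> tail q n a"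
  unfolding tail_def using assms by (intro mean_mono) auto

lemma tail_le_1:
  assumes q: "0 < q" "q < 1"
  shows "tail q n a \<le> 1"
proof -
  have "tail q n a \<le> mean q (pos n) (\<lambda>_. 1)"
    unfolding tail_def using q by (intro mean_mono) auto
  then show ?thesis by (simp add: mean_const)
qed

lemma tail_0: "a \<le> 0 \<Longrightarrow> tail q n a = 1"
  using order_trans[OF _ lcs_nonneg, of a n] by (simp add: tail_def mean_const)

text \<open>The cost of \<open>k\<close> blocks of length \<open>n\<close> followed by one block of
  length \<open>m\<close>.\<close>

lemma tail_power:
  assumes q: "0 < q" "q < 1"
  shows "tail q n a ^ k * tail q m b \<le> tail q (k * n + m) (real k * a + b)"
proof (induction k)
  case (Suc k)
  have "tail q n a ^ Suc k * tail q m b \<le> tail q n a * tail q (k * n + m) (real k * a + b)"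
    using Suc tail_nonneg[OF q, of n a] by (simp add: mult.assoc mult_left_mono)
  also have "\<dots> \<le> tail q (n + (k * n + m)) (a + (real k * a + b))"
    by (rule tail_mult[OF q])
  finally show ?case by (simp add: algebra_simps)
qed simp

lemma tail_1_pos:
  assumes q: "0 < q" "q < 1"
  shows "0 < tail q 1 1"
proof -
  have "lcs_length ([True], [True]) \<ge> length [True]"
    by (rule lcs_length_ge) auto
  then have "1 \<le> lcs 1 {}"
    by (simp add: lcs_def zero_word_def)
  then have "0 < weight q (pos 1) {} * of_bool (1 \<le> lcs 1 {})"
    using q by (simp add: weight_pos)
  also have "\<dots> \<le> tail q 1 1"
    unfolding tail_def mean_def
    by (intro member_le_sum) (use q in \<open>auto intro: weight_nonneg\<close>)
  finally show ?thesis .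
qed

text \<open>With positive probability each of \<open>n\<close> blocks of length one has LCS one.
  This keeps the logarithms of tails at thresholds up to \<open>n\<close> genuine.\<close>

lemma tail_pos:
  assumes q: "0 < q" "q < 1" and a: "a \<le> real n"
  shows "0 < tail q n a"
proof -
  have "0 < tail q 1 1 ^ n * tail q 0 0"
    using tail_1_pos[OF q] by (simp add: tail_0)
  also have "\<dots> \<le> tail q n (real n)"
    using tail_power[OF q, of 1 1 n 0 0] by simp
  also have "\<dots> \<le> tail q n a"
    by (rule tail_antimono[OF q a])
  finally show ?thesis .
qed

lemma mean_lcs_le:
  assumes q: "0 < q" "q < 1"
  shows "mean_lcs q n \<le> real n"
proof -
  have "mean_lcs q n \<le> mean q (pos n) (\<lambda>_. real n)"
    unfolding mean_lcs_def using q by (intro mean_mono lcs_le) auto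
  then show ?thesis by (simp add: mean_const)
qed

text \<open>The deficit \<open>real n - mean_lcs q n\<close> is nonnegative and subadditive, so
  Fekete's lemma applies to it; its nonnegative limit gives \<open>\<gamma> \<le> 1\<close>.\<close>

lemma mean_lcs_limit:
  assumes q: "0 < q" "q < 1"
  obtains \<gamma> where "(\<lambda>n. mean_lcs q n / real n) \<longlonglongrightarrow> \<gamma>" "\<gamma> \<le> 1"
proof -
  obtain l where l: "(\<lambda>n. (real n - mean_lcs q n) / real n) \<longlonglongrightarrow> l" "0 \<le> l"
  proof (rule fekete)
    show "real (m + n) - mean_lcs q (m + n) \<le> (real m - mean_lcs q m) + (real n - mean_lcs q n)"
      for m n using mean_lcs_add[OF q, of m n] by simp
    show "0 \<le> real n - mean_lcs q n" for n
      using mean_lcs_le[OF q, of n] by simp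
  qed
  have "(\<lambda>n. 1 - (real n - mean_lcs q n) / real n) \<longlonglongrightarrow> 1 - l"
    by (intro tendsto_intros l(1))
  moreover have "\<forall>\<^sub>F n in sequentially. 1 - (real n - mean_lcs q n) / real n = mean_lcs q n / real n"
    using eventually_gt_at_top[of 0] by eventually_elim (simp add: field_simps)
  ultimately have "(\<lambda>n. mean_lcs q n / real n) \<longlonglongrightarrow> 1 - l"
    by (blast intro: Lim_transform_eventually)
  then show ?thesis by (rule that) (use l(2) in simp)
qed

text \<open>For \<open>s \<le> 1\<close> all tails are positive, so Fekete's lemma applies to their
  negative logarithms. The bound valid for every \<open>n\<close> is the infimum form of the
  rate.\<close>

lemma tail_rate_limit:
  assumes q: "0 < q" "q < 1" and s: "s \<le> 1"
  obtains r where "(\<lambda>n. - ln (tail q n (s * real n)) / real n) \<longlonglongrightarrow> r"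
    "\<And>n. r * real n \<le> - ln (tail q n (s * real n))" "0 \<le> r"
proof (rule fekete[of "\<lambda>n. - ln (tail q n (s * real n))"])
  have pos: "0 < tail q n (s * real n)" for n
    using mult_right_mono[OF s, of "real n"] by (intro tail_pos[OF q]) simp
  show "- ln (tail q (m + n) (s * real (m + n)))
      \<le> - ln (tail q m (s * real m)) + - ln (tail q n (s * real n))" for m n
  proof -
    have "ln (tail q m (s * real m) * tail q n (s * real n)) \<le> ln (tail q (m + n) (s * real (m + n)))"
      using tail_mult[OF q, of m "s * real m" n "s * real n"] pos
      by (intro ln_mono) (auto simp: distrib_left)
    then show ?thesis using pos[of m] pos[of n] by (simp add: ln_mult)
  qed
  show "0 \<le> - ln (tail q n (s * real n))" for n
    using pos[of n] tail_le_1[OF q, of n "s * real n"] by simp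
qed (rule that)

text \<open>A reverse Markov inequality: the LCS is at most \<open>n\<close> on the tail event and
  below \<open>a\<close> off it. It turns a lower bound on the mean into one on the tail.\<close>

lemma tail_markov:
  assumes q: "0 < q" "q < 1"
  shows "mean_lcs q n \<le> real n * tail q n a + a * (1 - tail q n a)"
proof -
  have "mean_lcs q n \<le> mean q (pos n) (\<lambda>A. (real n - a) * of_bool (a \<le> lcs n A) + a)"
    unfolding mean_lcs_def using q lcs_le[of n] by (intro mean_mono) auto
  also have "\<dots> = (real n - a) * tail q n a + a"
    by (simp only: mean_add mean_cmult mean_const[OF finite_pos] tail_def)
  finally show ?thesis by (simp add: algebra_simps)
qed

text \<open>The slice mean is 1-Lipschitz in the number of zeros, which deviates from
  \<open>2 n q\<close> by at most \<open>sqrt (2 n)\<close> on average. The extra 1 allows for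
  rounding \<open>2 n q\<close> to \<open>u\<close>.\<close>

lemma slice_mean_near_mean:
  assumes q: "0 < q" "q < 1"
    and "u \<le> 2 * n" and u: "\<bar>real u - 2 * real n * q\<bar> \<le> 1"
  shows "mean_lcs q n \<le> slice_mean (pos n) (lcs n) u + sqrt (2 * real n) + 1"
proof -
  let ?d = "\<lambda>A. \<bar>real (card A) - real (card (pos n)) * q\<bar>"
  have "mean_lcs q n = mean q (pos n) (\<lambda>A. slice_mean (pos n) (lcs n) (card A))"
    unfolding mean_lcs_def by (rule mean_slice_mean) simp
  also have "\<dots> \<le> mean q (pos n) (\<lambda>A. slice_mean (pos n) (lcs n) u + (?d A + 1))"
  proof (rule mean_mono)
    fix A assume "A \<subseteq> pos n"
    then have "card A \<le> card (pos n)" by (intro card_mono) auto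
    then have "\<bar>slice_mean (pos n) (lcs n) (card A) - slice_mean (pos n) (lcs n) u\<bar>
        \<le> \<bar>real (card A) - real u\<bar>"
      using assms(3) by (intro slice_mean_lipschitz lcs_insert) auto
    then show "slice_mean (pos n) (lcs n) (card A) \<le> slice_mean (pos n) (lcs n) u + (?d A + 1)"
      using u unfolding card_pos of_nat_mult of_nat_numeral by linarith
  qed (use q in auto)
  also have "\<dots> = slice_mean (pos n) (lcs n) u + (mean q (pos n) ?d + 1)"
    by (simp only: mean_add mean_const[OF finite_pos])
  also have "\<dots> \<le> slice_mean (pos n) (lcs n) u + (sqrt (real (card (pos n))) + 1)"
    using q by (intro add_left_mono add_right_mono mean_abs_card_diff) auto
  finally show ?thesis by simp
qed

subsection \<open>Transfer to the probability space\<close>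

text \<open>The random set of indices carrying the letter 0; each index belongs to it with
  probability \<open>1 - p\<close>.\<close>

definition zeros :: "('i \<Rightarrow> 'a \<Rightarrow> bool) \<Rightarrow> 'i set \<Rightarrow> 'a \<Rightarrow> 'i set" where
  "zeros V I \<omega> = {j \<in> I. \<not> V j \<omega>}"

definition bernoulli_family :: "'a measure \<Rightarrow> ('i \<Rightarrow> 'a \<Rightarrow> bool) \<Rightarrow> real \<Rightarrow> bool" where
  "bernoulli_family M V p \<longleftrightarrow> prob_space M \<and>
     prob_space.indep_vars M (\<lambda>_. count_space UNIV) V UNIV \<and>
     (\<forall>j. measure M {\<omega> \<in> space M. V j \<omega>} = p)"

lemma events_letter:
  assumes "bernoulli_family M V p"
  shows "V j -` B \<inter> space M \<in> sets M"
proof -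
  have "V j \<in> measurable M (count_space UNIV)"
    using assms unfolding bernoulli_family_def by (auto simp: prob_space.indep_vars_def)
  then show ?thesis by (rule measurable_sets) simp
qed

lemma prob_letter:
  assumes V: "bernoulli_family M V p"
  shows "measure M (V j -` {b} \<inter> space M) = (if b then p else 1 - p)"
proof -
  have P: "prob_space M" and p: "measure M {\<omega> \<in> space M. V j \<omega>} = p"
    using V by (auto simp: bernoulli_family_def)
  have eq: "V j -` {b} \<inter> space M = (if b then {\<omega> \<in> space M. V j \<omega>} else {\<omega> \<in> space M. \<not> V j \<omega>})"
    by auto
  have "{\<omega> \<in> space M. V j \<omega>} \<in> sets M"
    using events_letter[OF V, of j "{True}"] by (simp add: vimage_def Int_def conj_commute)
  then have "measure M {\<omega> \<in> space M. \<not> V j \<omega>} = 1 - p"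
    using prob_space.prob_neg[OF P] p by simp
  then show ?thesis unfolding eq using p by simp
qed

lemma zeros_eq_iff:
  assumes "A \<subseteq> I"
  shows "zeros V I \<omega> = A \<longleftrightarrow> (\<forall>j\<in>I. V j \<omega> = (j \<notin> A))"
  using assms unfolding zeros_def by blast

lemma events_zeros:
  assumes V: "bernoulli_family M V p" and I: "finite I" "A \<subseteq> I"
  shows "{\<omega> \<in> space M. zeros V I \<omega> = A} \<in> sets M"
  unfolding zeros_eq_iff[OF I(2)]
proof (rule sets.sets_Collect_finite_All[OF _ I(1)])
  fix j
  have "{\<omega> \<in> space M. V j \<omega> = (j \<notin> A)} = V j -` {j \<notin> A} \<inter> space M"
    by auto
  then show "{\<omega> \<in> space M. V j \<omega> = (j \<notin> A)} \<in> sets M"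
    using events_letter[OF V] by simp
qed

lemma prob_zeros:
  assumes V: "bernoulli_family M V p" and I: "finite I" "A \<subseteq> I"
  shows "measure M {\<omega> \<in> space M. zeros V I \<omega> = A} = weight (1 - p) I A"
\<comment> \<open>The product rule for independent events is applied over a nonempty index set; for
  empty \<open>I\<close> both sides are 1.\<close>
proof (cases "I = {}")
  case True
  have "measure M (space M) = 1"
    using V by (simp add: bernoulli_family_def prob_space.prob_space)
  with True show ?thesis using I by (simp add: zeros_def weight_def)
next
  case False
  have P: "prob_space M" and indep: "prob_space.indep_vars M (\<lambda>_. count_space UNIV) V UNIV"
    using V by (simp_all add: bernoulli_family_def)
  have "{\<omega> \<in> space M. zeros V I \<omega> = A} = (\<Inter>j\<in>I. V j -` {j \<notin> A} \<inter> space M)"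
    unfolding zeros_eq_iff[OF I(2)] using False by auto
  then have "measure M {\<omega> \<in> space M. zeros V I \<omega> = A} =
      (\<Prod>j\<in>I. measure M (V j -` {j \<notin> A} \<inter> space M))"
    using prob_space.indep_varsD[OF P indep False I(1) subset_UNIV, of "\<lambda>j. {j \<notin> A}"]
    by simp
  also have "\<dots> = weight (1 - p) I A"
    unfolding weight_def prob_letter[OF V] by (intro prod.cong) auto
  finally show ?thesis .
qed

text \<open>\<open>zeros V I\<close> takes finitely many values, each on a measurable event, so the
  integral is a finite sum for arbitrary \<open>g\<close>.\<close>

lemma expectation_zeros:
  assumes V: "bernoulli_family M V p" and I: "finite I"
  shows "integral\<^sup>L M (\<lambda>\<omega>. g (zeros V I \<omega>)) = mean (1 - p) I g"
proof -
  have fin: "finite_measure M"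
    using V by (simp add: bernoulli_family_def prob_space.axioms)
  have "integral\<^sup>L M (\<lambda>\<omega>. g (zeros V I \<omega>)) =
      integral\<^sup>L M (\<lambda>\<omega>. \<Sum>A\<in>Pow I. g A * indicator {\<omega> \<in> space M. zeros V I \<omega> = A} \<omega>)"
  proof (rule Bochner_Integration.integral_cong)
    fix \<omega> assume "\<omega> \<in> space M"
    then have "(\<Sum>A\<in>Pow I. g A * indicator {\<omega> \<in> space M. zeros V I \<omega> = A} \<omega>) =
        (\<Sum>A\<in>Pow I. if A = zeros V I \<omega> then g A else 0)"
      by (intro sum.cong) auto
    also have "\<dots> = g (zeros V I \<omega>)"
      using I by (simp add: sum.delta) (auto simp: zeros_def)
    finally show "g (zeros V I \<omega>) =
        (\<Sum>A\<in>Pow I. g A * indicator {\<omega> \<in> space M. zeros V I \<omega> = A} \<omega>)" by simp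
  qed simp
  also have "\<dots> = (\<Sum>A\<in>Pow I. g A * measure M {\<omega> \<in> space M. zeros V I \<omega> = A})"
    using I by (subst Bochner_Integration.integral_sum)
      (auto intro!: integrable_mult_right simp: events_zeros[OF V] integrable_indicator_iff
        finite_measure.emeasure_eq_measure[OF fin])
  also have "\<dots> = mean (1 - p) I g"
    unfolding mean_def using I by (intro sum.cong) (auto simp: prob_zeros[OF V])
  finally show ?thesis .
qed

lemma prob_zeros_Collect:
  assumes V: "bernoulli_family M V p" and I: "finite I"
  shows "measure M {\<omega> \<in> space M. P (zeros V I \<omega>)} = mean (1 - p) I (\<lambda>A. of_bool (P A))"
proof -
  have "integral\<^sup>L M (indicat_real {\<omega> \<in> space M. P (zeros V I \<omega>)}) =
      integral\<^sup>L M (\<lambda>\<omega>. of_bool (P (zeros V I \<omega>)))"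
    by (intro Bochner_Integration.integral_cong) auto
  moreover have "{\<omega> \<in> space M. P (zeros V I \<omega>)} \<inter> space M = {\<omega> \<in> space M. P (zeros V I \<omega>)}"
    by auto
  ultimately show ?thesis
    using expectation_zeros[OF V I, of "\<lambda>A. of_bool (P A)"] by simp
qed

lemma bernoulli_family_letters:
  assumes "binary_lcs M X Y p"
  shows "bernoulli_family M (case_sum X Y) p"
proof -
  have "measure M {\<omega> \<in> space M. case_sum X Y j \<omega>} = p" for j
    using binary_lcs.prob_X[OF assms] binary_lcs.prob_Y[OF assms] by (cases j) simp_all
  then show ?thesis
    using binary_lcs.axioms(1)[OF assms] binary_lcs.indep[OF assms]
    by (simp add: bernoulli_family_def)
qed

lemma Z_eq:
  assumes "binary_lcs M X Y p"
  shows "binary_lcs.Z X Y n \<omega> = zero_word n (zeros (case_sum X Y) (pos n) \<omega>)"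
  by (auto simp: binary_lcs.Z_def[OF assms] zero_word_def zeros_def pos_def)

lemma L_eq:
  assumes "binary_lcs M X Y p"
  shows "binary_lcs.L X Y n \<omega> = lcs n (zeros (case_sum X Y) (pos n) \<omega>)"
  by (simp add: binary_lcs.L_def[OF assms] Z_eq[OF assms] lcs_def)

lemma U_eq:
  assumes "binary_lcs M X Y p"
  shows "binary_lcs.U X Y n \<omega> = card (zeros (case_sum X Y) (pos n) \<omega>)"
  unfolding binary_lcs.U_def[OF assms] Z_eq[OF assms]
  by (rule num_zeros_zero_word) (auto simp: zeros_def)

lemma expectation_L:
  assumes model: "binary_lcs M X Y p"
  shows "integral\<^sup>L M (binary_lcs.L X Y n) = mean_lcs (1 - p) n"
  unfolding mean_lcs_def L_eq[OF model, abs_def]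
  by (rule expectation_zeros[OF bernoulli_family_letters[OF model] finite_pos])

lemma prob_L_ge:
  assumes model: "binary_lcs M X Y p"
  shows "measure M {\<omega> \<in> space M. binary_lcs.L X Y n \<omega> \<ge> a} = tail (1 - p) n a"
  unfolding tail_def L_eq[OF model]
  by (rule prob_zeros_Collect[OF bernoulli_family_letters[OF model] finite_pos])

text \<open>Numerator and denominator of \<open>ell\<close> share the binomial probability of
  \<open>u\<close> zeros, which is positive for \<open>u \<le> 2 * n\<close> and cancels.\<close>

lemma ell_eq:
  assumes model: "binary_lcs M X Y p" and u: "u \<le> 2 * n"
  shows "binary_lcs.ell M X Y n u = slice_mean (pos n) (lcs n) u"
proof -
  let ?D = "zeros (case_sum X Y) (pos n)"
  note V = bernoulli_family_letters[OF model]
  have "Bernstein (2 * n) u (1 - p) > 0"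
    using u binary_lcs.p_pos[OF model] binary_lcs.p_less_1[OF model] by (intro Bernstein_pos) auto
  moreover have "integral\<^sup>L M (\<lambda>\<omega>. lcs n (?D \<omega>) * indicator {\<omega> \<in> space M. card (?D \<omega>) = u} \<omega>) =
      Bernstein (2 * n) u (1 - p) * slice_mean (pos n) (lcs n) u"
  proof -
    have "integral\<^sup>L M (\<lambda>\<omega>. lcs n (?D \<omega>) * indicator {\<omega> \<in> space M. card (?D \<omega>) = u} \<omega>) =
        integral\<^sup>L M (\<lambda>\<omega>. (\<lambda>A. lcs n A * of_bool (card A = u)) (?D \<omega>))"
      by (intro Bochner_Integration.integral_cong) auto
    also have "\<dots> = mean (1 - p) (pos n) (\<lambda>A. lcs n A * of_bool (card A = u))"
      by (rule expectation_zeros[OF V finite_pos])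
    finally show ?thesis
      by (simp add: mean_restrict_card)
  qed
  moreover have "measure M {\<omega> \<in> space M. card (?D \<omega>) = u} = Bernstein (2 * n) u (1 - p)"
  proof -
    have "slice_mean (pos n) (\<lambda>_. 1) u = 1"
      using u n_subsets[OF finite_pos, of n u] by (simp add: slice_mean_def)
    then show ?thesis
      using mean_restrict_card[OF finite_pos, of "1 - p" n "\<lambda>_. 1" u]
      by (simp add: prob_zeros_Collect[OF V finite_pos, of "\<lambda>A. card A = u" n])
  qed
  ultimately show ?thesis
    by (simp add: binary_lcs.ell_def[OF model] L_eq[OF model] U_eq[OF model])
qed

subsection \<open>The bound on the rate function\<close>

text \<open>\<open>M_gen q\<close> is the moment generating function of a centred Bernoulli
  variable. Expanding the first exponential to second order and the other to first order, the linear
  terms cancel and \<open>1 + x\<close> remains, with \<open>x\<close> as defined below. Then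
  \<open>exp (x / 2) \<le> 1 + x\<close> gives the Gaussian form at the price of half the
  exponent.\<close>

lemma M_gen_lower_bound:
  assumes q: "0 < q" "q < 1" and "0 \<le> \<tau>" "\<tau> \<le> 1"
  shows "exp (q * (1 - q)\<^sup>2 * \<tau>\<^sup>2 / 4) \<le> M_gen q \<tau>"
proof -
  define x where "x = q * (1 - q)\<^sup>2 * \<tau>\<^sup>2 / 2"
  have "q * (1 - q)\<^sup>2 * \<tau>\<^sup>2 \<le> 1"
    using assms by (intro mult_le_one power_le_one zero_le_power) auto
  then have x: "0 \<le> x / 2" "x / 2 \<le> 1"
    using q unfolding x_def by auto
  have "exp (x / 2) \<le> 1 + x / 2 + (x / 2)\<^sup>2"
    using x by (rule exp_bound)
  also have "(x / 2)\<^sup>2 \<le> x / 2 * 1"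
    unfolding power2_eq_square using x by (intro mult_left_mono) auto
  finally have "exp (x / 2) \<le> 1 + x" by simp
  also have "1 + x = (1 + \<tau> * (1 - q) + (\<tau> * (1 - q))\<^sup>2 / 2) * q + (1 + (- \<tau> * q)) * (1 - q)"
    unfolding x_def by (simp add: power2_eq_square field_simps)
  also have "\<dots> \<le> M_gen q \<tau>"
    unfolding M_gen_def
    using assms exp_lower_Taylor_quadratic[of "\<tau> * (1 - q)"] exp_ge_add_one_self[of "- \<tau> * q"]
    by (intro add_mono mult_right_mono) auto
  finally show ?thesis by (simp add: x_def)
qed

lemma eventually_sqrt_le:
  assumes "0 < c"
  shows "\<forall>\<^sub>F n in sequentially. sqrt (real n) \<le> c * real n"
proof -
  obtain N :: nat where N: "1 / c\<^sup>2 < real N"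
    using reals_Archimedean2 by blast
  show ?thesis
  proof (rule eventually_sequentiallyI)
    fix n assume "N \<le> n"
    with N have "1 / c\<^sup>2 \<le> real n" by linarith
    then have "1 * real n \<le> (real n * c\<^sup>2) * real n"
      using assms by (intro mult_right_mono) (simp_all add: divide_le_eq)
    also have "\<dots> = (c * real n)\<^sup>2"
      by (simp add: power2_eq_square)
    finally have "sqrt (real n) \<le> sqrt ((c * real n)\<^sup>2)"
      by (intro real_sqrt_le_mono) simp
    then show "sqrt (real n) \<le> c * real n"
      using assms by simp
  qed
qed

text \<open>Writes \<open>ln (n + 1)\<close> as \<open>2 ln (sqrt (n + 1))\<close> and uses
  \<open>ln y \<le> y - 1\<close>.\<close>

lemma ln_Suc_le_sqrt: "ln (real n + 1) \<le> 2 * sqrt (real n)"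
proof -
  have "sqrt (real n + 1) \<le> sqrt (real n) + 1"
    using sqrt_add_le_add_sqrt[of "real n" 1] by simp
  moreover have "ln (sqrt (real n + 1)) \<le> sqrt (real n + 1) - 1"
    by (rule ln_le_minus_one) simp
  ultimately show ?thesis
    by (simp add: ln_sqrt)
qed

section \<open>Interpolating the rate between the typical level and a higher one\<close>

lemma slope_le:
  fixes \<alpha> \<beta> :: real
  assumes "\<And>k. k0 \<le> k \<Longrightarrow> \<alpha> * real k \<le> \<beta> * real k + D"
  shows "\<alpha> \<le> \<beta>"
proof (rule ccontr)
  assume "\<not> \<alpha> \<le> \<beta>"
  then have pos: "0 < \<alpha> - \<beta>" by simp
  obtain k :: nat where k: "real k > max (real k0) (D / (\<alpha> - \<beta>))"
    using reals_Archimedean2 by blast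
  with pos have "D < (\<alpha> - \<beta>) * real k"
    by (simp add: divide_less_eq mult.commute)
  with assms[of k] k show False by (simp add: algebra_simps)
qed

text \<open>The mean per letter eventually exceeds the midpoint of \<open>s'\<close> and
  \<open>\<gamma>\<close>; the reverse Markov inequality at level \<open>s' m\<close> then bounds
  the tail below uniformly in \<open>m\<close>.\<close>

lemma tail_below_limit:
  assumes q: "0 < q" "q < 1"
    and lim: "(\<lambda>n. mean_lcs q n / real n) \<longlonglongrightarrow> \<gamma>" and \<gamma>_le: "\<gamma> \<le> 1"
    and s': "s' < \<gamma>"
  obtains C m0 where "0 < C" "\<And>m. m0 \<le> m \<Longrightarrow> C \<le> tail q m (s' * real m)"
proof -
  define C where "C = (\<gamma> - s') / 2 / (1 - s')"
  have "(s' + \<gamma>) / 2 < \<gamma>" using s' by simp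
  from order_tendstoD(1)[OF lim this]
  have "\<forall>\<^sub>F m in sequentially. C \<le> tail q m (s' * real m)"
    using eventually_gt_at_top[of 0]
  proof eventually_elim
    case (elim m)
    have "mean_lcs q m \<le> real m * (s' + (1 - s') * tail q m (s' * real m))"
      using tail_markov[OF q, of m "s' * real m"] by (simp add: algebra_simps)
    with elim(2) have "mean_lcs q m / real m \<le> s' + (1 - s') * tail q m (s' * real m)"
      by (simp add: divide_le_eq mult.commute)
    with elim(1) have "(\<gamma> - s') / 2 \<le> (1 - s') * tail q m (s' * real m)"
      by argo
    moreover have "0 < 1 - s'" using s' \<gamma>_le by simp
    ultimately show ?case
      by (simp only: C_def pos_divide_le_eq mult.commute)
  qed
  moreover have "0 < C"
    unfolding C_def using s' \<gamma>_le by simp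
  ultimately show ?thesis
    using that unfolding eventually_sequentially by blast
qed

text \<open>The event \<open>L\<^sub>N \<ge> s N\<close> is reached by concatenating many blocks of length \<open>n\<close>, on each of which
  the LCS is at least \<open>a > s n\<close>, with one long block on which it is only slightly below its typical
  value \<open>\<gamma> m\<close>; the latter costs nothing at the exponential scale.\<close>

lemma rate_le_aux:
  assumes q: "0 < q" "q < 1"
    and lim: "(\<lambda>n. mean_lcs q n / real n) \<longlonglongrightarrow> \<gamma>" and \<gamma>_le: "\<gamma> \<le> 1"
    and r: "0 \<le> r" "\<And>N. r * real N \<le> - ln (tail q N (s * real N))"
    and s: "\<gamma> < s" "s \<le> 1" and s': "s' < \<gamma>" and t: "0 < t"
    and a: "s * real n < a" "exp (- t * (a - \<gamma> * real n)) \<le> tail q n a"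
  shows "r \<le> t * (s - s')"
proof -
  \<comment> \<open>Each short block exceeds its target by \<open>a - s n\<close>, and the long
    block falls short by \<open>s - s'\<close> per letter. So one short block pays for
    \<open>e\<close> letters of the long block.\<close>
  define e where "e = (a - s * real n) / (s - s')"
  have ss': "0 < s - s'" using s s' by simp
  have e: "0 < e" unfolding e_def using a ss' by simp
  obtain C m0 where C: "0 < C" "\<And>m. m0 \<le> m \<Longrightarrow> C \<le> tail q m (s' * real m)"
    by (rule tail_below_limit[OF q lim \<gamma>_le s']) (rule that)
  obtain K0 :: nat where K0: "real m0 / e < real K0"
    using reals_Archimedean2 by blast
  \<comment> \<open>With \<open>K\<close> short blocks the total length is about
    \<open>K (n + e)\<close>; comparing growth in \<open>K\<close> removes all bounded
    terms.\<close>
  have "r * (real n + e) \<le> t * (a - \<gamma> * real n)"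
  proof (rule slope_le)
    fix K :: nat assume "K0 \<le> K"
    define m where "m = nat \<lfloor>real K * e\<rfloor>"
    define N where "N = K * n + m"
    have m: "real m \<le> real K * e" "real K * e - 1 \<le> real m"
      unfolding m_def using e by auto
    have "real m0 < real K * e"
      using K0 \<open>K0 \<le> K\<close> e by (simp add: divide_less_eq) (meson less_le_trans mult_right_mono of_nat_le_iff order_less_imp_le)
    then have "m0 \<le> m" unfolding m_def by (simp add: le_nat_floor)
    have "real m * (s - s') \<le> real K * (a - s * real n)"
      using m(1) ss' unfolding e_def by (simp add: field_simps)
    then have le: "s * real N \<le> real K * a + s' * real m"
      unfolding N_def by (simp add: algebra_simps)
    have "exp (- t * (a - \<gamma> * real n)) ^ K * C \<le> tail q n a ^ K * tail q m (s' * real m)"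
      using a(2) C \<open>m0 \<le> m\<close> tail_nonneg[OF q] by (intro mult_mono power_mono) auto
    also have "\<dots> \<le> tail q N (real K * a + s' * real m)"
      unfolding N_def by (rule tail_power[OF q])
    also have "\<dots> \<le> tail q N (s * real N)"
      by (rule tail_antimono[OF q le])
    finally have "ln (exp (- t * (a - \<gamma> * real n)) ^ K * C) \<le> ln (tail q N (s * real N))"
      using C(1) by (intro ln_mono) auto
    then have "- ln (tail q N (s * real N)) \<le> t * (a - \<gamma> * real n) * real K - ln C"
      using C(1) by (simp add: ln_mult ln_realpow algebra_simps)
    then have "r * real N \<le> t * (a - \<gamma> * real n) * real K - ln C"
      using r(2)[of N] by linarith
    moreover have "r * ((real n + e) * real K - 1) \<le> r * real N"
      using m(2) r(1) unfolding N_def by (intro mult_left_mono) (simp_all add: algebra_simps)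
    \<comment> \<open>The constant \<open>r - ln C\<close> collects the rounding of \<open>m\<close>
      and the bounded cost of the long block.\<close>
    ultimately show "r * (real n + e) * real K \<le> t * (a - \<gamma> * real n) * real K + (r - ln C)"
      by (simp add: algebra_simps)
  qed
  \<comment> \<open>Replacing \<open>\<gamma>\<close> by the smaller \<open>s'\<close> makes the
    factor \<open>n + e\<close> appear on the right as well, so that it can be cancelled.\<close>
  also have "\<dots> \<le> t * (a - s' * real n)"
    using t s' by (intro mult_left_mono) (auto intro: mult_right_mono)
  also have "a - s' * real n = (real n + e) * (s - s')"
    unfolding e_def using ss' by (simp add: field_simps)
  finally have "r * (real n + e) \<le> (t * (s - s')) * (real n + e)"
    by (simp add: mult_ac)
  then show ?thesis
    using e by (simp add: add_nonneg_pos)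
qed

text \<open>Lets \<open>s'\<close> increase to \<open>\<gamma>\<close>: the choice
  \<open>s' = \<gamma> - e / t\<close> costs exactly \<open>e\<close>.\<close>

lemma rate_le:
  assumes q: "0 < q" "q < 1"
    and lim: "(\<lambda>n. mean_lcs q n / real n) \<longlonglongrightarrow> \<gamma>" and \<gamma>_le: "\<gamma> \<le> 1"
    and "0 \<le> r" "\<And>N. r * real N \<le> - ln (tail q N (s * real N))"
    and "\<gamma> < s" "s \<le> 1" and t: "0 < t"
    and "s * real n < a" "exp (- t * (a - \<gamma> * real n)) \<le> tail q n a"
  shows "r \<le> t * (s - \<gamma>)"
proof (rule field_le_epsilon)
  fix e :: real assume "0 < e"
  with t have "\<gamma> - e / t < \<gamma>" by simp
  from rate_le_aux[OF assms(1-8) this assms(9-11)] have "r \<le> t * (s - (\<gamma> - e / t))" .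
  also have "\<dots> = t * (s - \<gamma>) + e"
    using t by (simp add: field_simps)
  finally show "r \<le> t * (s - \<gamma>) + e" .
qed

text \<open>The LCS is an integer \<open>k \<le> n\<close>, and the summand at this \<open>k\<close>
  already equals the exponential on the left.\<close>

lemma moment_le_sum_tail:
  assumes q: "0 < q" "q < 1"
  shows "mean q (pos n) (\<lambda>A. exp (t * (lcs n A - l))) \<le> (\<Sum>k\<le>n. exp (t * (real k - l)) * tail q n (real k))"
proof -
  have "mean q (pos n) (\<lambda>A. exp (t * (lcs n A - l))) \<le>
      mean q (pos n) (\<lambda>A. \<Sum>k\<le>n. exp (t * (real k - l)) * of_bool (real k \<le> lcs n A))"
  proof (rule mean_mono)
    fix A
    define k where "k = lcs_length (zero_word n A)"
    have k: "lcs n A = real k" by (simp add: k_def lcs_def)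
    then have "k \<le> n" using lcs_le[of n A] by simp
    have "exp (t * (lcs n A - l)) = exp (t * (real k - l)) * of_bool (real k \<le> lcs n A)"
      by (simp add: k)
    also have "\<dots> \<le> (\<Sum>k\<le>n. exp (t * (real k - l)) * of_bool (real k \<le> lcs n A))"
      using \<open>k \<le> n\<close> by (intro member_le_sum[of k]) auto
    finally show "exp (t * (lcs n A - l)) \<le> \<dots>" .
  qed (use q in auto)
  then show ?thesis
    by (simp only: mean_sum mean_cmult tail_def)
qed

text \<open>By pigeonhole, one of the \<open>n + 1\<close> levels carries the average share of the
  moment. The factor \<open>\<nu> n\<close>, the count \<open>n + 1\<close> and the gap between
  \<open>l n\<close> and \<open>\<gamma> n\<close> each cost at most \<open>t d n / 4\<close> of the
  exponent \<open>2 t d n\<close>, leaving \<open>5 / 4\<close> of \<open>t d n\<close>.\<close>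

lemma exists_likely_level:
  fixes l :: "nat \<Rightarrow> real"
  assumes q: "0 < q" "q < 1"
    and t: "0 < t" and d: "0 < d"
    and moment: "\<forall>\<^sub>F n in sequentially.
      \<nu> n * exp (2 * t * d * real n) \<le> mean q (pos n) (\<lambda>A. exp (t * (lcs n A - l n)))"
    and \<nu>: "\<forall>\<^sub>F n in sequentially. 0 < \<nu> n" "(\<lambda>n. ln (\<nu> n)) \<in> o(\<lambda>n. real n)"
    and l: "\<forall>\<^sub>F n in sequentially. \<gamma> * real n \<le> l n + d / 4 * real n"
  obtains n k where "k \<le> n" "(\<gamma> + d) * real n < real k"
    "exp (- t * (real k - \<gamma> * real n)) \<le> tail q n (real k)"
proof -
  have td: "0 < t * d / 4" using t d by simp
  have ln_\<nu>: "\<forall>\<^sub>F n in sequentially. \<bar>ln (\<nu> n)\<bar> \<le> t * d / 4 * real n"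
    using landau_o.smallD[OF \<nu>(2) td] by simp
  have "0 < t * d / 8" using td by simp
  from eventually_sqrt_le[OF this]
  have ln_n: "\<forall>\<^sub>F n in sequentially. ln (real n + 1) \<le> t * d / 4 * real n"
  proof eventually_elim
    case (elim n)
    with ln_Suc_le_sqrt[of n] show ?case by simp
  qed
  obtain n where n: "0 < n"
      "\<nu> n * exp (2 * t * d * real n) \<le> mean q (pos n) (\<lambda>A. exp (t * (lcs n A - l n)))"
      "0 < \<nu> n" "\<gamma> * real n \<le> l n + d / 4 * real n"
      "\<bar>ln (\<nu> n)\<bar> \<le> t * d / 4 * real n" "ln (real n + 1) \<le> t * d / 4 * real n"
    using eventually_happens[OF eventually_conj[OF eventually_gt_at_top[of 0] eventually_conj[OF moment
      eventually_conj[OF \<nu>(1) eventually_conj[OF l eventually_conj[OF ln_\<nu> ln_n]]]]]]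
    by auto
  define W where "W = \<nu> n * exp (2 * t * d * real n) / (real n + 1)"
  have "\<exists>k\<le>n. W \<le> exp (t * (real k - l n)) * tail q n (real k)"
  proof (rule ccontr)
    assume "\<not> ?thesis"
    then have "(\<Sum>k\<le>n. exp (t * (real k - l n)) * tail q n (real k)) < (\<Sum>k\<le>n. W)"
      by (intro sum_strict_mono) auto
    also have "\<dots> = \<nu> n * exp (2 * t * d * real n)"
      unfolding W_def by (simp add: field_simps)
    finally show False
      using n(2) moment_le_sum_tail[OF q, of n t "l n"] by linarith
  qed
  then obtain k where k: "k \<le> n" "W \<le> exp (t * (real k - l n)) * tail q n (real k)"
    by blast
  have "W = exp (ln (\<nu> n) + 2 * t * d * real n - ln (real n + 1))"
    unfolding W_def using n(3) by (simp add: exp_add exp_diff)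
  then have "exp (ln (\<nu> n) + 2 * t * d * real n - ln (real n + 1)) / exp (t * (real k - l n)) \<le> tail q n (real k)"
    using k(2) by (simp add: divide_le_eq mult.commute)
  then have tail: "exp (ln (\<nu> n) + 2 * t * d * real n - ln (real n + 1) - t * (real k - l n)) \<le> tail q n (real k)"
    by (simp add: exp_diff)
  have "t * (\<gamma> * real n) \<le> t * (l n + d / 4 * real n)"
    using n(4) t by (intro mult_left_mono) auto
  then have "5 / 4 * (t * d * real n) - t * (real k - \<gamma> * real n) \<le>
      ln (\<nu> n) + 2 * t * d * real n - ln (real n + 1) - t * (real k - l n)"
    using n(5,6) by (simp add: algebra_simps abs_le_iff)
  then have lower: "exp (5 / 4 * (t * d * real n) - t * (real k - \<gamma> * real n)) \<le> tail q n (real k)"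
    using tail by (meson exp_le_cancel_iff order_trans)
  have tdn: "0 < t * d * real n" using t d n(1) by simp
  \<comment> \<open>A probability is at most 1, which forces \<open>k\<close> to lie at least
    \<open>5 / 4 * d * n\<close> above \<open>\<gamma> n\<close>: the surplus over
    \<open>t d n\<close> makes the level strictly exceed the target.\<close>
  have "exp (5 / 4 * (t * d * real n) - t * (real k - \<gamma> * real n)) \<le> 1"
    using lower tail_le_1[OF q] by (rule order_trans)
  then have "t * (d * real n) < t * (real k - \<gamma> * real n)"
    using tdn by simp
  then have "d * real n < real k - \<gamma> * real n"
    using t by (simp only: mult_less_cancel_left_pos)
  then have "(\<gamma> + d) * real n < real k"
    by (simp add: algebra_simps)
  moreover have "exp (- t * (real k - \<gamma> * real n)) \<le> tail q n (real k)"
    by (rule order_trans[OF _ lower]) (use tdn in simp)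
  ultimately show ?thesis using that k(1) by blast
qed

text \<open>Half of \<open>\<eta>\<close> covers the convergence of the mean and half the
  fluctuation of the number of zeros.\<close>

lemma slice_mean_lower_bound:
  assumes q: "0 < q" "q < 1"
    and lim: "(\<lambda>n. mean_lcs q n / real n) \<longlonglongrightarrow> \<gamma>"
    and \<eta>: "0 < \<eta>"
  shows "\<forall>\<^sub>F n in sequentially.
    \<gamma> * real n \<le> slice_mean (pos n) (lcs n) (nat \<lceil>2 * real n * q\<rceil>) + \<eta> * real n"
proof -
  have "\<gamma> - \<eta> / 2 < \<gamma>" using \<eta> by simp
  from order_tendstoD(1)[OF lim this]
  have mean: "\<forall>\<^sub>F n in sequentially. \<gamma> - \<eta> / 2 < mean_lcs q n / real n" .
  \<comment> \<open>For \<open>n \<ge> 1\<close>, \<open>sqrt (2 n) + 1\<close> is at most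
    \<open>3 sqrt n\<close>; hence a sixth of \<open>\<eta>\<close>.\<close>
  have "0 < \<eta> / 6" using \<eta> by simp
  from eventually_sqrt_le[OF this] eventually_gt_at_top[of 0]
  have sqrt: "\<forall>\<^sub>F n in sequentially. sqrt (2 * real n) + 1 \<le> \<eta> / 2 * real n"
  proof eventually_elim
    case (elim n)
    have "sqrt (2 * real n) \<le> sqrt (4 * real n)"
      by (intro real_sqrt_le_mono) simp
    also have "\<dots> = 2 * sqrt (real n)"
      by (simp add: real_sqrt_mult)
    finally have "sqrt (2 * real n) \<le> 2 * sqrt (real n)" .
    moreover have "1 \<le> sqrt (real n)" using elim(2) by simp
    ultimately show ?case using elim(1) by linarith
  qed
  from mean sqrt eventually_gt_at_top[of 0] show ?thesis
  proof eventually_elim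
    case (elim n)
    have "0 \<le> 2 * real n * q" "2 * real n * q \<le> 2 * real n"
      using q mult_left_le[of q "2 * real n"] by auto
    then have ceil: "0 \<le> \<lceil>2 * real n * q\<rceil>" "\<lceil>2 * real n * q\<rceil> \<le> 2 * int n"
      by linarith+
    have "mean_lcs q n \<le> slice_mean (pos n) (lcs n) (nat \<lceil>2 * real n * q\<rceil>) + sqrt (2 * real n) + 1"
    proof (rule slice_mean_near_mean[OF q])
      show "nat \<lceil>2 * real n * q\<rceil> \<le> 2 * n" using ceil by linarith
      show "\<bar>real (nat \<lceil>2 * real n * q\<rceil>) - 2 * real n * q\<bar> \<le> 1"
        using ceil(1) by (simp add: of_nat_nat) linarith
    qed
    moreover have "(\<gamma> - \<eta> / 2) * real n < mean_lcs q n"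
      using elim by (simp add: less_divide_eq)
    ultimately show ?case
      using elim by (simp add: algebra_simps)
  qed
qed

text \<open>For \<open>s \<le> 1\<close> the tails are positive, so the infinite branch of
  \<open>neg_ln\<close> is never taken and the extended limit is a real one.\<close>

lemma rate_eqI:
  assumes model: "binary_lcs M X Y p"
    and lim: "(\<lambda>n. - ln (tail (1 - p) n (s * real n)) / real n) \<longlonglongrightarrow> r" and s: "s \<le> 1"
  shows "binary_lcs.rate M X Y s = ereal r"
proof -
  have "(\<lambda>n. ereal (- ln (tail (1 - p) n (s * real n)) / real n)) \<longlonglongrightarrow> ereal r"
    using lim by simp
  moreover have "\<forall>\<^sub>F n in sequentially. ereal (- ln (tail (1 - p) n (s * real n)) / real n) =
      neg_ln (measure M {\<omega> \<in> space M. binary_lcs.L X Y n \<omega> \<ge> s * real n}) / ereal (real n)"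
    using eventually_gt_at_top[of 0]
  proof eventually_elim
    case (elim n)
    have "tail (1 - p) n (s * real n) \<noteq> 0"
      using tail_pos[of "1 - p" "s * real n" n] mult_right_mono[of s 1 "real n"] s
        binary_lcs.p_pos[OF model] binary_lcs.p_less_1[OF model]
      by simp
    with elim show ?case
      by (simp add: prob_L_ge[OF model] neg_ln_def)
  qed
  ultimately show ?thesis
    unfolding binary_lcs.rate_def[OF model] by (intro limI) (rule Lim_transform_eventually)
qed

theorem theorem5p4:
  fixes M :: "'a measure" and X Y :: "nat \<Rightarrow> 'a \<Rightarrow> bool" and p q :: real
    and p0 eps1 eps2 :: real and Bset :: "nat \<Rightarrow> word_pair set" and c1 :: "real \<Rightarrow> real"
  assumes model: "binary_lcs M X Y p" and q: "q = 1 - p"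
    and LM: "lember_matzinger p0 eps1 eps2 Bset c1"
    and p: "p \<in> {0<..<p0}"
    and moment_bound:
      "\<exists>t0 \<delta> :: real. \<exists>\<nu> :: nat \<Rightarrow> real.
         0 < t0 \<and> 0 < \<delta> \<and>
         (\<forall>n. 0 \<le> \<nu> n) \<and> (\<forall>\<^sub>F n in sequentially. 0 < \<nu> n) \<and> (\<lambda>n. ln (\<nu> n)) \<in> o(\<lambda>n. real n) \<and>
         (\<forall>t\<in>{0..t0}. \<forall>\<^sub>F n in sequentially.
            integral\<^sup>L M (\<lambda>\<omega>. exp (t * (binary_lcs.L X Y n \<omega>
                - binary_lcs.ell M X Y n (nat \<lceil>2 * real n * q\<rceil>))))
            \<ge> \<nu> n * M_gen q (\<delta> * t) ^ (2 * n))"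
  shows "\<exists>B \<gamma>' :: real. 0 < B \<and> 0 < \<gamma>' \<and>
           (\<forall>s\<in>{binary_lcs.gamma_star M X Y <.. binary_lcs.gamma_star M X Y + \<gamma>'}.
              binary_lcs.rate M X Y s \<le> ereal (B * (s - binary_lcs.gamma_star M X Y)\<^sup>2))"
proof -
  let ?L = "binary_lcs.L X Y" and ?ell = "binary_lcs.ell M X Y" and ?gamma_star = "binary_lcs.gamma_star M X Y"
  have q01: "0 < q" "q < 1" using binary_lcs.p_pos[OF model] binary_lcs.p_less_1[OF model] q by auto
  obtain \<gamma> where \<gamma>: "(\<lambda>n. mean_lcs q n / real n) \<longlonglongrightarrow> \<gamma>" "\<gamma> \<le> 1"
    by (rule mean_lcs_limit[OF q01])
  have gamma_star: "?gamma_star = \<gamma>"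
    unfolding binary_lcs.gamma_star_def[OF model] expectation_L[OF model] q[symmetric] using \<gamma>(1) by (rule limI)
  obtain t0 \<delta> \<nu> where t0: "0 < t0" and \<delta>: "0 < \<delta>"
    and \<nu>: "\<forall>\<^sub>F n in sequentially. 0 < \<nu> n" "(\<lambda>n. ln (\<nu> n)) \<in> o(\<lambda>n. real n)"
    and moment: "\<And>t. t \<in> {0..t0} \<Longrightarrow> \<forall>\<^sub>F n in sequentially.
      \<nu> n * M_gen q (\<delta> * t) ^ (2 * n) \<le>
      integral\<^sup>L M (\<lambda>\<omega>. exp (t * (?L n \<omega> - ?ell n (nat \<lceil>2 * real n * q\<rceil>))))"
    using moment_bound by auto
  \<comment> \<open>Raising the bound of \<open>M_gen_lower_bound\<close> at
    \<open>\<delta> t\<close> to the power \<open>2 n\<close> gives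
    \<open>exp (c t^2 n)\<close>.\<close>
  define c where "c = q * (1 - q)\<^sup>2 * \<delta>\<^sup>2 / 2"
  have c: "0 < c" unfolding c_def using q01 \<delta> by simp
  \<comment> \<open>Below \<open>t1\<close> both the moment hypothesis and
    \<open>M_gen_lower_bound\<close> at \<open>\<delta> t\<close> are available.\<close>
  define t1 where "t1 = min t0 (1 / \<delta>)"
  have t1: "0 < t1" "t1 \<le> t0" "\<delta> * t1 \<le> 1"
    unfolding t1_def using t0 \<delta> by (auto simp: min_def field_simps)
  let ?l = "\<lambda>n. slice_mean (pos n) (lcs n) (nat \<lceil>2 * real n * q\<rceil>)"
  have "binary_lcs.rate M X Y s \<le> ereal (2 / c * (s - \<gamma>)\<^sup>2)" if s: "\<gamma> < s" "s \<le> \<gamma> + c * t1 / 2" for s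
  proof -
    define d where "d = s - \<gamma>"
    \<comment> \<open>The gain \<open>c t^2 = 2 t d\<close> is twice the cost \<open>t d\<close>,
      which leaves room for the errors. The range \<open>d \<le> c * t1 / 2\<close> is exactly
      \<open>t \<le> t1\<close>.\<close>
    define t where "t = 2 * d / c"
    have d: "0 < d" using s by (simp add: d_def)
    have t: "0 < t" "t \<le> t1"
      using s c d by (auto simp: t_def d_def field_simps)
    have "t \<in> {0..t0}" using t t1 by simp
    have moment_t: "\<forall>\<^sub>F n in sequentially.
        \<nu> n * exp (2 * t * d * real n) \<le> mean q (pos n) (\<lambda>A. exp (t * (lcs n A - ?l n)))"
      using moment[OF \<open>t \<in> {0..t0}\<close>] \<nu>(1)
    proof eventually_elim
      case (elim n)
      have "exp (2 * t * d * real n) = exp (q * (1 - q)\<^sup>2 * (\<delta> * t)\<^sup>2 / 4) ^ (2 * n)"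
      proof -
        have "q * (1 - q)\<^sup>2 * (\<delta> * t)\<^sup>2 / 4 = c * t * t / 2"
          by (simp add: c_def power2_eq_square)
        also have "\<dots> = t * d" using c by (simp add: t_def)
        finally show ?thesis
          by (simp add: exp_of_nat_mult[symmetric] mult_ac)
      qed
      also have "\<dots> \<le> M_gen q (\<delta> * t) ^ (2 * n)"
      proof -
        have "\<delta> * t \<le> 1"
          using mult_left_mono[OF t(2), of \<delta>] \<delta> t1(3) by linarith
        then show ?thesis
          using q01 t(1) \<delta> by (intro power_mono M_gen_lower_bound) auto
      qed
      finally have "\<nu> n * exp (2 * t * d * real n) \<le> \<nu> n * M_gen q (\<delta> * t) ^ (2 * n)"
        using elim by (intro mult_left_mono) auto
      also have "\<dots> \<le> integral\<^sup>L M (\<lambda>\<omega>. exp (t * (?L n \<omega> - ?ell n (nat \<lceil>2 * real n * q\<rceil>))))"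
        using elim by simp
      also have "?ell n (nat \<lceil>2 * real n * q\<rceil>) = ?l n"
        using q01 mult_left_le[of q "2 * real n"]
        by (intro ell_eq[OF model]) (simp add: nat_le_iff ceiling_le_iff)
      also have "integral\<^sup>L M (\<lambda>\<omega>. exp (t * (?L n \<omega> - ?l n))) =
          mean q (pos n) (\<lambda>A. exp (t * (lcs n A - ?l n)))"
        unfolding L_eq[OF model] q by (rule expectation_zeros[OF bernoulli_family_letters[OF model] finite_pos])
      finally show ?case .
    qed
    have lower: "\<forall>\<^sub>F n in sequentially. \<gamma> * real n \<le> ?l n + d / 4 * real n"
      using d by (intro slice_mean_lower_bound[OF q01 \<gamma>(1)]) auto
    obtain n k where nk: "k \<le> n" "(\<gamma> + d) * real n < real k"
        "exp (- t * (real k - \<gamma> * real n)) \<le> tail q n (real k)"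
      using exists_likely_level[OF q01 t(1) d moment_t \<nu>] lower by blast
    \<comment> \<open>The level \<open>k\<close> lies above \<open>s n\<close> and is at most
      \<open>n\<close>, so the moment bound itself forces \<open>s < 1\<close> and the rate at
      \<open>s\<close> is finite.\<close>
    have "s * real n < 1 * real n" using nk by (simp add: d_def)
    then have "s < 1" by (rule mult_right_less_imp_less) simp
    then have "s \<le> 1" by simp
    obtain r where r: "(\<lambda>n. - ln (tail q n (s * real n)) / real n) \<longlonglongrightarrow> r"
        "\<And>n. r * real n \<le> - ln (tail q n (s * real n))" "0 \<le> r"
      using tail_rate_limit[OF q01] \<open>s \<le> 1\<close> by metis
    have "r \<le> t * (s - \<gamma>)"
      using rate_le[OF q01 \<gamma> r(3,2) s(1) \<open>s \<le> 1\<close> t(1) _ nk(3)] nk(2) by (simp add: d_def)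
    also have "\<dots> = 2 / c * (s - \<gamma>)\<^sup>2"
      by (simp add: t_def d_def power2_eq_square)
    finally show ?thesis
      using rate_eqI[OF model _ \<open>s \<le> 1\<close>, of r] r(1) by (simp add: q)
  qed
  moreover have "0 < 2 / c" "0 < c * t1 / 2" using c t1 by auto
  ultimately show ?thesis
    unfolding gamma_star by (intro exI[of _ "2 / c"] exI[of _ "c * t1 / 2"]) auto
qed

end
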